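(* There is an absolute constant $C>0$ such that the following holds for every integer $n\ge 1$ and every real $\epsilon\in(0,1/2]$. Let $k$ be an integer with $$k\ \ge\ \frac{C}{\epsilon^2}\log^2\!\left(\frac1\epsilon\right),$$ let $\mathcal D$ be a $k$-wise independent distribution on $\{-1,+1\}^n$, and let $h:\{-1,+1\}^n\to\{-1,+1\}$ be a halfspace. Then $\mathcal D$ fools $h$ with error $\epsilon$, i.e. $$\bigl|\mathbf E_{x\leftarrow\mathcal D}[h(x)]-\mathbf E_{x\leftarrow\mathcal U}[h(x)]\bigr|\le\epsilon,$$ where $\mathcal U$ is the uniform distribution on $\{-1,+1\}^n$.
   Context: $\mathrm{sign}(t)=+1$ for $t\ge 0$ and $\mathrm{sign}(t)=-1$ for $t<0$. A halfspace is a function $h:\{-1,+1\}^n\to\{-1,+1\}$ of the form $h(x)=\mathrm{sign}(w_1x_1+\dots+w_nx_n-\theta)$ with arbitrary $w_1,\dots,w_n,\theta\in\mathbf R$. A distribution $\mathcal D$ on $\{-1,+1\}^n$ is $k$-wise independent if its projection onto any set of at most $k$ coordinates is uniform (so for $k\ge n$ this means $\mathcal D$ is uniform). *)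

theory Defs
  imports "HOL-Probability.Probability"
begin

text \<open>
  The dimension \<open>n\<close> is quantified inside the statement, so \<open>{-1,+1}^n\<close> is a set of
  (extensional) functions on \<open>{..<n}\<close> and not a type. Coordinates are numbered from 0.
\<close>

definition cube_on :: "nat set \<Rightarrow> (nat \<Rightarrow> real) set" where
  "cube_on S = PiE S (\<lambda>_. {-1, 1})"

abbreviation cube :: "nat \<Rightarrow> (nat \<Rightarrow> real) set" where
  "cube n \<equiv> cube_on {..<n}"

text \<open>Unlike the library function \<^const>\<open>sgn\<close>, this takes the value 1 at 0.\<close>

definition sign_pm :: "real \<Rightarrow> real" where
  "sign_pm t = (if t \<ge> 0 then 1 else - 1)"

text \<open>Values of \<open>h\<close> outside the cube are irrelevant and left unconstrained.\<close>

definition halfspace :: "nat \<Rightarrow> ((nat \<Rightarrow> real) \<Rightarrow> real) \<Rightarrow> bool" where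
  "halfspace n h \<longleftrightarrow>
     (\<exists>(w :: nat \<Rightarrow> real) (\<theta> :: real). \<forall>x\<in>cube n. h x = sign_pm ((\<Sum>i<n. w i * x i) - \<theta>))"

definition distribution_on_cube :: "nat \<Rightarrow> (nat \<Rightarrow> real) pmf \<Rightarrow> bool" where
  "distribution_on_cube n D \<longleftrightarrow> set_pmf D \<subseteq> cube n"

definition k_wise_independent :: "nat \<Rightarrow> nat \<Rightarrow> (nat \<Rightarrow> real) pmf \<Rightarrow> bool" where
  "k_wise_independent n k D \<longleftrightarrow>
     (\<forall>S\<subseteq>{..<n}. card S \<le> k \<longrightarrow> map_pmf (\<lambda>x. restrict x S) D = pmf_of_set (cube_on S))"

definition fools :: "nat \<Rightarrow> (nat \<Rightarrow> real) pmf \<Rightarrow> ((nat \<Rightarrow> real) \<Rightarrow> real) \<Rightarrow> real \<Rightarrow> bool" where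
  "fools n D h \<epsilon> \<longleftrightarrow>
     \<bar>measure_pmf.expectation D h - measure_pmf.expectation (pmf_of_set (cube n)) h\<bar> \<le> \<epsilon>"

end

theory Submission imports Defs "HOL-Complex_Analysis.Cauchy_Integral_Formula" begin

text \<open>
  Call a set of weights regular if each weight is at most \<open>\<delta>\<close> times their Euclidean norm, where
  \<open>\<delta>\<close> is a small multiple of \<open>\<epsilon>\<close>. For regular weights, rescaled to norm
  \<open>1 / (2 * \<delta>)\<close>, the sign is replaced by a primitive \<open>\<phi>\<close> of \<open>sinc x ^ 4\<close>, at a cost dominated by
  a sum of two shifted squares of sinc. All these functions are entire of exponential type, so by Cauchy's
  estimates and the sub-Gaussian moments of a Rademacher sum their Taylor polynomials of degree of
  order \<open>1 / \<delta>\<^sup>2\<close> are accurate on average, and the expectations under the two distributions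
  agree up to a negligible error. Under the uniform distribution the squares of sinc have
  expectation of order \<open>\<delta>\<close>, by an integral of the characteristic function.

  For arbitrary weights, greedily move weights violating regularity into a head. Each move shrinks the
  squared norm of the tail by a factor \<open>1 - \<delta>\<^sup>2\<close>. Either the tail becomes regular after
  \<open>O(ln(1/\<epsilon>)\<^sup>2 / \<delta>\<^sup>2)\<close> moves, and one conditions on the head, or the head contains
  \<open>O(ln(1/\<epsilon>))\<close> weights decreasing so fast that the head sum is almost never close to the threshold,
  and then the tail, being much smaller, does not matter by Chebyshev's inequality.
\<close>

section \<open>Entire functions of exponential type\<close>

lemma norm_cos_le_exp_Im: "norm (cos z) \<le> exp \<bar>Im z\<bar>" for z :: complex
proof -
  have "norm (exp (\<i> * z) + exp (- (\<i> * z))) \<le> exp (- Im z) + exp (Im z)"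
    by (rule order_trans[OF norm_triangle_ineq]) simp
  also have "\<dots> \<le> 2 * exp \<bar>Im z\<bar>"
    by (cases "Im z \<ge> 0") (auto intro: add_mono)
  finally show ?thesis
    by (simp add: cos_exp_eq norm_divide)
qed

text \<open>Mean value inequality on the horizontal strip bounded by the height of \<open>z\<close>:
  it is convex, contains 0 and \<open>z\<close>, and the derivative \<open>cos\<close> is at most
  \<open>exp \<bar>Im z\<bar>\<close> on it.\<close>

lemma norm_sin_le_exp_Im: "norm (sin z) \<le> norm z * exp \<bar>Im z\<bar>" for z :: complex
proof -
  let ?S = "{w. \<bar>Im w\<bar> \<le> \<bar>Im z\<bar>}"
  have "?S = {w. Im w \<le> \<bar>Im z\<bar>} \<inter> {w. Im w \<ge> - \<bar>Im z\<bar>}" by auto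
  then have S: "convex ?S"
    by (auto intro: convex_Int convex_halfspace_Im_le convex_halfspace_Im_ge)
  have "norm (sin z - sin 0) \<le> exp \<bar>Im z\<bar> * norm (z - 0)"
  proof (rule field_differentiable_bound[OF S])
    show "(sin has_field_derivative cos w) (at w within ?S)" for w :: complex
      by (rule DERIV_subset[OF DERIV_sin]) simp
    show "norm (cos w) \<le> exp \<bar>Im z\<bar>" if "w \<in> ?S" for w :: complex
      using norm_cos_le_exp_Im[of w] that by (auto intro: order_trans)
  qed auto
  then show ?thesis by (simp add: mult.commute)
qed

text \<open>The entire extension of the real function \<open>sinc\<close>, to which Cauchy's
  estimates apply.\<close>

definition csinc :: "complex \<Rightarrow> complex" where
  "csinc z = (if z = 0 then 1 else sin z / z)"

lemma csinc_of_real: "csinc (of_real x) = of_real (if x = 0 then 1 else sin x / x)"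
  by (simp add: csinc_def sin_of_real)

text \<open>The singularity at 0 is removable: \<open>csinc\<close> is the difference quotient of
  \<open>sin\<close> at 0, completed by the value \<open>deriv sin 0 = 1\<close>.\<close>

lemma csinc_holomorphic: "csinc holomorphic_on UNIV"
proof -
  have "(\<lambda>z. if z = 0 then deriv sin 0 else (sin z - sin 0) / (z - 0)) holomorphic_on (UNIV :: complex set)"
    by (intro pole_lemma_open) (auto intro: holomorphic_intros)
  moreover have "deriv sin (0::complex) = 1"
    using DERIV_imp_deriv[OF DERIV_sin[of "0::complex"]] by simp
  ultimately show ?thesis by (simp add: csinc_def[abs_def] cong: if_cong)
qed

lemma norm_csinc_le: "norm (csinc z) \<le> exp \<bar>Im z\<bar>"
  using norm_sin_le_exp_Im[of z] by (auto simp: csinc_def norm_divide field_simps)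

lemma norm_csinc_power_le: "norm (csinc z ^ p) \<le> exp (real p * \<bar>Im z\<bar>)"
  using power_mono[OF norm_csinc_le[of z], of p] by (simp add: norm_power exp_of_nat_mult[symmetric])

text \<open>A circle of radius \<open>r\<close> about a real point stays in the strip
  \<open>\<bar>Im z\<bar> \<le> r\<close>, where \<open>f\<close> is at most
  \<open>exp (b * r)\<close>, whatever \<open>x\<close> is. The radius is left free so that it can
  grow with the order of the derivative.\<close>

lemma deriv_bound_of_exponential_type:
  assumes hol: "f holomorphic_on UNIV" and bnd: "\<And>z. norm (f z) \<le> exp (b * \<bar>Im z\<bar>)"
    and b: "b \<ge> 0" and r: "r > 0"
  shows "norm ((deriv ^^ n) f (of_real x)) \<le> fact n * exp (b * r) / r ^ n"
proof (rule Cauchy_inequality)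
  show "f holomorphic_on ball (of_real x) r" using hol by (rule holomorphic_on_subset) simp
  show "continuous_on (cball (of_real x) r) f"
    using holomorphic_on_imp_continuous_on[OF hol] by (rule continuous_on_subset) simp
  fix z :: complex assume z: "norm (of_real x - z) = r"
  have "\<bar>Im z\<bar> \<le> r" using abs_Im_le_cmod[of "of_real x - z"] z by simp
  then have "b * \<bar>Im z\<bar> \<le> b * r" using b by (rule mult_left_mono)
  with bnd[of z] show "norm (f z) \<le> exp (b * r)" by (meson exp_le_cancel_iff order_trans)
qed (fact r)

text \<open>Taylor's theorem is applied along the real line, so a bound on the derivative there
  suffices. Increments are real, hence the \<open>c i\<close> are the real parts of the Taylor
  coefficients at \<open>a\<close>.\<close>

lemma Taylor_Re:
  assumes hol: "f holomorphic_on UNIV"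
    and B: "\<And>x::real. norm ((deriv ^^ Suc n) f (of_real x)) \<le> B"
  shows "\<exists>c::nat\<Rightarrow>real. \<forall>x::real. \<bar>Re (f (of_real (a + x))) - (\<Sum>i\<le>n. c i * x ^ i)\<bar> \<le> B * \<bar>x\<bar> ^ Suc n / fact n"
proof (intro exI allI)
  fix x :: real
  let ?D = "\<lambda>i. (deriv ^^ i) f"
  let ?c = "\<lambda>i. Re (?D i (of_real a)) / fact i"
  have "norm (?D 0 (of_real (a+x)) - (\<Sum>i\<le>n. ?D i (of_real a) * (of_real (a+x) - of_real a) ^ i / fact i))
     \<le> B * norm (of_real (a+x) - of_real a :: complex) ^ Suc n / fact n"
  proof (rule complex_Taylor[where S = "range of_real"])
    show "convex (range complex_of_real)"
      by (rule convex_linear_image) (auto intro: linearI simp: scaleR_conv_of_real)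
    show "(?D i has_field_derivative ?D (Suc i) z) (at z within range complex_of_real)" for i z
      using holomorphic_derivI[OF holomorphic_higher_deriv[OF hol open_UNIV] open_UNIV, of z i]
      by (auto intro: DERIV_subset)
    show "norm (?D (Suc n) z) \<le> B" if "z \<in> range complex_of_real" for z
      using that B by blast
  qed (auto simp del: of_real_add)
  moreover have "Re (?D 0 (of_real (a+x)) - (\<Sum>i\<le>n. ?D i (of_real a) * (of_real (a+x) - of_real a) ^ i / fact i))
     = Re (f (of_real (a + x))) - (\<Sum>i\<le>n. ?c i * x ^ i)"
  proof -
    have "Re (?D i (of_real a) * (of_real (a+x) - of_real a) ^ i / fact i) = ?c i * x ^ i" for i
    proof -
      have "?D i (of_real a) * (of_real (a+x) - of_real a) ^ i / fact i
        = of_real (x ^ i / fact i) * ?D i (of_real a)" by simp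
      also have "Re \<dots> = x ^ i / fact i * Re (?D i (of_real a))"
        by (metis Re_complex_of_real Im_complex_of_real times_complex.sel(1) mult_zero_left diff_zero)
      also have "\<dots> = ?c i * x ^ i" by simp
      finally show ?thesis .
    qed
    then show ?thesis by simp
  qed
  ultimately show "\<bar>Re (f (of_real (a + x))) - (\<Sum>i\<le>n. ?c i * x ^ i)\<bar> \<le> B * \<bar>x\<bar> ^ Suc n / fact n"
    using abs_Re_le_cmod[of "?D 0 (of_real (a+x)) - (\<Sum>i\<le>n. ?D i (of_real a) * (of_real (a+x) - of_real a) ^ i / fact i)"]
    by (simp add: norm_mult)
qed

lemma Suc_le_exp_Suc: "real (Suc n) \<le> exp (real (Suc n))"
  using exp_ge_add_one_self[of "real (Suc n)"] by simp

text \<open>Cauchy's estimate is used with radius \<open>Suc n\<close>, the order of the remainder.\<close>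

lemma Taylor_exponential_type:
  assumes hol: "f holomorphic_on UNIV" and bnd: "\<And>z. norm (f z) \<le> exp (b * \<bar>Im z\<bar>)" and b: "b \<ge> 0"
  shows "\<exists>c::nat\<Rightarrow>real. \<forall>x::real. \<bar>Re (f (of_real (a + x))) - (\<Sum>i\<le>n. c i * x ^ i)\<bar>
           \<le> (exp (b + 1) * \<bar>x\<bar> / real (Suc n)) ^ Suc n"
proof -
  let ?r = "real (Suc n)"
  let ?B = "fact (Suc n) * exp (b * ?r) / ?r ^ Suc n"
  obtain c :: "nat\<Rightarrow>real" where c: "\<And>x. \<bar>Re (f (of_real (a + x))) - (\<Sum>i\<le>n. c i * x ^ i)\<bar>
      \<le> ?B * \<bar>x\<bar> ^ Suc n / fact n"
    using Taylor_Re[OF hol deriv_bound_of_exponential_type[OF hol bnd b, where r = ?r and n = "Suc n"], of a] by auto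
  have "?B * \<bar>x\<bar> ^ Suc n / fact n \<le> (exp (b + 1) * \<bar>x\<bar> / ?r) ^ Suc n" for x :: real
  proof -
    have "?B * \<bar>x\<bar> ^ Suc n / fact n = ?r * (exp b ^ Suc n * (\<bar>x\<bar> / ?r) ^ Suc n)"
      by (simp add: exp_of_nat_mult[symmetric] power_divide mult.commute field_simps del: power_Suc of_nat_Suc)
    \<comment> \<open>The factorials leave a factor \<open>Suc n\<close>; bounding it by
      \<open>exp (Suc n)\<close> is what turns \<open>b\<close> into \<open>b + 1\<close>.\<close>
    also have "\<dots> \<le> exp ?r * (exp b ^ Suc n * (\<bar>x\<bar> / ?r) ^ Suc n)"
      by (intro mult_right_mono Suc_le_exp_Suc) auto
    also have "\<dots> = (exp (b + 1) * \<bar>x\<bar> / ?r) ^ Suc n"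
      using exp_of_nat_mult[of "Suc n" "1::real"]
      by (simp add: exp_add power_mult_distrib power_divide field_simps del: power_Suc of_nat_Suc)
    finally show ?thesis .
  qed
  then show ?thesis using c by (meson order_trans)
qed

text \<open>The growth bound is now on \<open>deriv f\<close>, so Cauchy's estimate is applied to
  the derivative of order \<open>n\<close> of \<open>deriv f\<close>. This gives one power of the
  radius less in the denominator, again a factor \<open>Suc n\<close> that \<open>b + 1\<close>
  absorbs.\<close>

lemma Taylor_exponential_type_primitive:
  assumes hol: "f holomorphic_on UNIV" and bnd: "\<And>z. norm (deriv f z) \<le> exp (b * \<bar>Im z\<bar>)" and b: "b \<ge> 0"
  shows "\<exists>c::nat\<Rightarrow>real. \<forall>x::real. \<bar>Re (f (of_real (a + x))) - (\<Sum>i\<le>n. c i * x ^ i)\<bar>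
           \<le> (exp (b + 1) * \<bar>x\<bar> / real (Suc n)) ^ Suc n"
proof -
  let ?r = "real (Suc n)"
  let ?B = "fact n * exp (b * ?r) / ?r ^ n"
  have hol': "deriv f holomorphic_on UNIV" by (intro holomorphic_deriv hol open_UNIV)
  have "norm ((deriv ^^ Suc n) f (of_real x)) \<le> ?B" for x :: real
    using deriv_bound_of_exponential_type[OF hol' bnd b, where r = ?r and n = n and x = x] by (simp add: funpow_Suc_right del: funpow.simps)
  then obtain c :: "nat\<Rightarrow>real" where c: "\<And>x. \<bar>Re (f (of_real (a + x))) - (\<Sum>i\<le>n. c i * x ^ i)\<bar>
      \<le> ?B * \<bar>x\<bar> ^ Suc n / fact n"
    using Taylor_Re[OF hol, of n ?B a] by auto
  have "?B * \<bar>x\<bar> ^ Suc n / fact n \<le> (exp (b + 1) * \<bar>x\<bar> / ?r) ^ Suc n" for x :: real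
  proof -
    have "?B * \<bar>x\<bar> ^ Suc n / fact n = exp b ^ Suc n * \<bar>x\<bar> ^ Suc n / ?r ^ n"
      by (simp add: exp_of_nat_mult[symmetric] mult.commute del: power_Suc of_nat_Suc)
    also have "\<dots> = ?r * (exp b ^ Suc n * (\<bar>x\<bar> / ?r) ^ Suc n)"
      by (simp add: power_divide)
    also have "\<dots> \<le> exp ?r * (exp b ^ Suc n * (\<bar>x\<bar> / ?r) ^ Suc n)"
      by (intro mult_right_mono Suc_le_exp_Suc) auto
    also have "\<dots> = (exp (b + 1) * \<bar>x\<bar> / ?r) ^ Suc n"
      using exp_of_nat_mult[of "Suc n" "1::real"]
      by (simp add: exp_add power_mult_distrib power_divide field_simps del: power_Suc of_nat_Suc)
    finally show ?thesis .
  qed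
  then show ?thesis using c by (meson order_trans)
qed

section \<open>Averages over the cube\<close>

lemma finite_cube_on: "finite J \<Longrightarrow> finite (cube_on J)"
  by (simp add: cube_on_def finite_PiE)

lemma card_cube_on: "finite J \<Longrightarrow> card (cube_on J) = 2 ^ card J"
  by (simp add: cube_on_def card_PiE numeral_2_eq_2)

lemma cube_on_empty: "cube_on {} = {\<lambda>_. undefined}"
  by (simp add: cube_on_def)

lemma cube_on_nonempty: "cube_on J \<noteq> {}"
  by (simp add: cube_on_def PiE_eq_empty_iff)

lemma sum_cube_on_insert:
  assumes "finite J" "i \<notin> J"
  shows "(\<Sum>y\<in>cube_on (insert i J). g y) = (\<Sum>y\<in>cube_on J. g (y(i := 1)) + g (y(i := -1)))"
proof -
  have "cube_on (insert i J) = (\<lambda>(v, y). y(i := v)) ` ({-1, 1} \<times> cube_on J)"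
    unfolding cube_on_def by (rule PiE_insert_eq)
  moreover have "inj_on (\<lambda>(v, y). y(i := v)) ({-1, 1} \<times> cube_on J)"
    unfolding cube_on_def by (rule inj_combinator) fact
  ultimately have "(\<Sum>y\<in>cube_on (insert i J). g y) = (\<Sum>(v, y)\<in>{-1, 1} \<times> cube_on J. g (y(i := v)))"
    by (simp add: sum.reindex case_prod_unfold)
  also have "\<dots> = (\<Sum>v\<in>{-1, 1}. \<Sum>y\<in>cube_on J. g (y(i := v)))"
    by (simp add: sum.cartesian_product)
  finally show ?thesis by (simp add: sum.distrib add.commute)
qed

text \<open>The uniform expectation as a finite sum, suited to induction over the coordinates;
  \<open>expectation_uniform\<close> links it to \<open>pmf_of_set\<close>.\<close>

definition cube_avg :: "nat set \<Rightarrow> ((nat \<Rightarrow> real) \<Rightarrow> real) \<Rightarrow> real" where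
  "cube_avg J g = (\<Sum>y\<in>cube_on J. g y) / 2 ^ card J"

lemma cube_avg_empty: "cube_avg {} g = g (\<lambda>_. undefined)"
  by (simp add: cube_avg_def cube_on_empty)

lemma cube_avg_insert:
  "finite J \<Longrightarrow> i \<notin> J \<Longrightarrow> cube_avg (insert i J) g = cube_avg J (\<lambda>y. (g (y(i := 1)) + g (y(i := -1))) / 2)"
  by (simp add: cube_avg_def sum_cube_on_insert sum_divide_distrib[symmetric])

lemma cube_avg_cong: "(\<And>y. y \<in> cube_on J \<Longrightarrow> f y = g y) \<Longrightarrow> cube_avg J f = cube_avg J g"
  by (simp add: cube_avg_def)

lemma cube_avg_mono: "(\<And>y. y \<in> cube_on J \<Longrightarrow> f y \<le> g y) \<Longrightarrow> cube_avg J f \<le> cube_avg J g"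
  by (simp add: cube_avg_def divide_right_mono sum_mono)

lemma cube_avg_abs: "\<bar>cube_avg J f\<bar> \<le> cube_avg J (\<lambda>y. \<bar>f y\<bar>)"
  by (simp add: cube_avg_def divide_right_mono)

lemma cube_avg_const: "finite J \<Longrightarrow> cube_avg J (\<lambda>y. c) = c"
  by (simp add: cube_avg_def card_cube_on)

lemma cube_avg_add: "cube_avg J (\<lambda>y. f y + g y) = cube_avg J f + cube_avg J g"
  by (simp add: cube_avg_def sum.distrib add_divide_distrib)

lemma cube_avg_diff: "cube_avg J (\<lambda>y. f y - g y) = cube_avg J f - cube_avg J g"
  by (simp add: cube_avg_def sum_subtractf diff_divide_distrib)

lemma cube_avg_cmult: "cube_avg J (\<lambda>y. c * f y) = c * cube_avg J f"
  by (simp add: cube_avg_def sum_distrib_left)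

lemma cube_avg_divide: "cube_avg J (\<lambda>y. f y / c) = cube_avg J f / c"
  by (simp add: cube_avg_def sum_divide_distrib[symmetric])

lemma cube_avg_sum: "cube_avg J (\<lambda>y. \<Sum>i\<in>I. f i y) = (\<Sum>i\<in>I. cube_avg J (f i))"
  by (simp add: cube_avg_def sum_divide_distrib[symmetric] sum.swap[of _ I])

lemma linear_form_upd:
  fixes a :: "nat \<Rightarrow> real"
  assumes "finite J" "i \<notin> J"
  shows "(\<Sum>j\<in>insert i J. a j * (y(i := v)) j) = a i * v + (\<Sum>j\<in>J. a j * y j)"
  using assms by (auto intro: sum.cong)

text \<open>The characteristic function of a Rademacher sum, with a phase \<open>b\<close>:
  averaging over the sign of coordinate \<open>i\<close> splits off the factor
  \<open>cos (a i)\<close>.\<close>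

lemma cube_avg_cos:
  assumes "finite J"
  shows "cube_avg J (\<lambda>y. cos ((\<Sum>i\<in>J. a i * y i) + b)) = cos b * (\<Prod>i\<in>J. cos (a i))"
  using assms
proof (induction J)
  case (insert i J)
  have "(cos (a i * 1 + t + b) + cos (a i * -1 + t + b)) / 2 = cos (a i) * cos (t + b)" for t
    using cos_times_cos[of "t + b" "a i"] by (simp add: algebra_simps)
  then show ?case
    by (simp add: cube_avg_insert linear_form_upd insert cube_avg_cmult del: fun_upd_apply sum.insert)
qed (simp add: cube_avg_empty)

lemma cube_avg_exp:
  assumes "finite J"
  shows "cube_avg J (\<lambda>y. exp (\<Sum>i\<in>J. a i * y i)) = (\<Prod>i\<in>J. cosh (a i))"
  using assms
proof (induction J)
  case (insert i J)
  have "(exp (a i * 1 + t) + exp (a i * -1 + t)) / 2 = cosh (a i) * exp t" for t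
    by (simp add: cosh_def exp_add exp_diff exp_minus field_simps)
  then show ?case
    by (simp add: cube_avg_insert linear_form_upd insert cube_avg_cmult del: fun_upd_apply sum.insert)
qed (simp add: cube_avg_empty)

lemma cube_avg_square:
  assumes "finite J"
  shows "cube_avg J (\<lambda>y. (\<Sum>i\<in>J. a i * y i)\<^sup>2) = (\<Sum>i\<in>J. (a i)\<^sup>2)"
  using assms
proof (induction J)
  case (insert i J)
  have "((a i * 1 + t)\<^sup>2 + (a i * -1 + t)\<^sup>2) / 2 = (a i)\<^sup>2 + t\<^sup>2" for t
    by (simp add: power2_eq_square field_simps)
  then have "cube_avg (insert i J) (\<lambda>y. (\<Sum>j\<in>insert i J. a j * y j)\<^sup>2) = (a i)\<^sup>2 + (\<Sum>j\<in>J. (a j)\<^sup>2)"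
    by (simp add: cube_avg_insert linear_form_upd insert add_divide_distrib cube_avg_add cube_avg_const
          del: fun_upd_apply sum.insert)
  then show ?case using insert by simp
qed (simp add: cube_avg_empty)

section \<open>Sub-Gaussian moments of Rademacher sums\<close>

lemma even_power_le_cosh:
  fixes x :: real
  assumes "even k"
  shows "x ^ k / fact k \<le> cosh x"
proof -
  let ?f = "\<lambda>n. if even n then x ^ n / fact n else 0"
  have s: "?f sums cosh x" using cosh_converges[of x] by (simp add: divide_inverse_commute if_distrib cong: if_cong)
  have "sum ?f {k} \<le> suminf ?f"
    by (rule sum_le_suminf) (use s in \<open>auto simp: sums_iff zero_le_even_power\<close>)
  then show ?thesis using s assms by (simp add: sums_iff)
qed

text \<open>For \<open>t \<ge> 0\<close> the difference of the logarithms has derivative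
  \<open>t - tanh t\<close>, which is nonnegative because it vanishes at 0 and has derivative
  \<open>tanh\<close> squared. Negative arguments follow by evenness.\<close>

lemma cosh_le_exp_square:
  fixes x :: real
  shows "cosh x \<le> exp (x\<^sup>2 / 2)"
proof -
  have nonneg: "cosh t \<le> exp (t\<^sup>2 / 2)" if "t \<ge> 0" for t :: real
  proof -
    have "0 \<le> t\<^sup>2 / 2 - ln (cosh t)"
    proof -
      have "(\<lambda>t::real. t\<^sup>2 / 2 - ln (cosh t)) 0 \<le> (\<lambda>t. t\<^sup>2 / 2 - ln (cosh t)) t"
      proof (rule DERIV_nonneg_imp_nondecreasing[OF that])
        fix s :: real assume "0 \<le> s" "s \<le> t"
        have "((\<lambda>t::real. t\<^sup>2 / 2 - ln (cosh t)) has_real_derivative (s - tanh s)) (at s)"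
          by (auto intro!: derivative_eq_intros simp: tanh_def field_simps cosh_real_pos)
        moreover have "tanh s \<le> s"
        proof -
          have "(\<lambda>s::real. s - tanh s) 0 \<le> (\<lambda>s. s - tanh s) s"
          proof (rule DERIV_nonneg_imp_nondecreasing[OF \<open>0 \<le> s\<close>])
            fix u :: real
            have "((\<lambda>s::real. s - tanh s) has_real_derivative (tanh u)\<^sup>2) (at u)"
              by (auto intro!: derivative_eq_intros)
            then show "\<exists>y. ((\<lambda>s::real. s - tanh s) has_real_derivative y) (at u) \<and> 0 \<le> y" by force
          qed
          then show ?thesis by simp
        qed
        ultimately show "\<exists>y. ((\<lambda>t::real. t\<^sup>2 / 2 - ln (cosh t)) has_real_derivative y) (at s) \<and> 0 \<le> y"
          by (intro exI[of _ "s - tanh s"]) simp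
      qed
      then show ?thesis by simp
    qed
    then have "ln (cosh t) \<le> t\<^sup>2 / 2" by simp
    then show ?thesis by (metis cosh_real_pos exp_le_cancel_iff exp_ln)
  qed
  show ?thesis using nonneg[of "\<bar>x\<bar>"] by (simp add: cosh_real_abs)
qed

lemma cube_avg_exp_le:
  assumes "finite J"
  shows "cube_avg J (\<lambda>y. exp (\<Sum>i\<in>J. a i * y i)) \<le> exp ((\<Sum>i\<in>J. (a i)\<^sup>2) / 2)"
proof -
  have "(\<Prod>i\<in>J. cosh (a i)) \<le> (\<Prod>i\<in>J. exp ((a i)\<^sup>2 / 2))"
    by (intro prod_mono) (simp add: cosh_le_exp_square)
  then show ?thesis
    unfolding cube_avg_exp[OF assms] sum_divide_distrib by (simp add: exp_sum[OF assms])
qed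

text \<open>The moment is read off the moment generating function at \<open>\<lambda> = sqrt (k / v)\<close>.\<close>

lemma cube_avg_even_moment:
  assumes J: "finite J" and k: "even k" "k > 0" and v: "v = (\<Sum>i\<in>J. (a i)\<^sup>2)" "v > 0"
  shows "cube_avg J (\<lambda>y. (\<Sum>i\<in>J. a i * y i) ^ k) \<le> fact k * (exp 1 * v / real k) ^ (k div 2)"
proof -
  define l where "l = sqrt (real k / v)"
  have l: "l > 0" "l\<^sup>2 = real k / v" using k v(2) by (auto simp: l_def)
  have lk: "l ^ k = (real k / v) ^ (k div 2)"
    using k(1) l(2) by (metis dvd_mult_div_cancel power_mult)
  let ?Y = "\<lambda>y. \<Sum>i\<in>J. a i * y i"
  have scale: "(\<Sum>i\<in>J. (c * a i) * y i) = c * ?Y y" for c y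
    by (simp add: sum_distrib_left mult.assoc)
  have sq: "(\<Sum>i\<in>J. (c * a i)\<^sup>2) = c\<^sup>2 * v" for c
    by (simp add: v sum_distrib_left power_mult_distrib)
  have E: "cube_avg J (\<lambda>y. exp (c * ?Y y)) \<le> exp (c\<^sup>2 * v / 2)" for c
    using cube_avg_exp_le[OF J, of "\<lambda>i. c * a i"] by (simp only: scale sq)
  have "l ^ k / fact k * cube_avg J (\<lambda>y. ?Y y ^ k) = cube_avg J (\<lambda>y. (l * ?Y y) ^ k / fact k)"
    by (simp add: cube_avg_cmult[symmetric] power_mult_distrib)
  \<comment> \<open>One term of the power series of \<open>cosh\<close> is at most
    \<open>cosh\<close>, the mean of the two exponentials that \<open>E\<close> controls at
    \<open>l\<close> and \<open>- l\<close>.\<close>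
  also have "\<dots> \<le> cube_avg J (\<lambda>y. (exp (l * ?Y y) + exp (- l * ?Y y)) / 2)"
    using even_power_le_cosh[OF k(1)] by (intro cube_avg_mono) (simp add: cosh_def)
  also have "\<dots> \<le> exp (l\<^sup>2 * v / 2)"
    using E[of l] E[of "-l"] by (simp add: cube_avg_divide cube_avg_add)
  also have "l\<^sup>2 * v / 2 = real (k div 2) * 1"
    using l v(2) k(1) by (auto simp: field_simps)
  also have "exp \<dots> = exp 1 ^ (k div 2)"
    by (rule exp_of_nat_mult)
  finally have "fact k * (l ^ k / fact k * cube_avg J (\<lambda>y. ?Y y ^ k)) \<le> fact k * exp 1 ^ (k div 2)"
    by (intro mult_left_mono) auto
  then have "cube_avg J (\<lambda>y. ?Y y ^ k) * (real k / v) ^ (k div 2) \<le> fact k * exp 1 ^ (k div 2)"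
    by (simp add: lk mult.commute)
  then have "cube_avg J (\<lambda>y. ?Y y ^ k) \<le> fact k * exp 1 ^ (k div 2) / (real k / v) ^ (k div 2)"
    using k v(2) by (subst pos_le_divide_eq) auto
  also have "\<dots> = fact k * (exp 1 * v / real k) ^ (k div 2)"
    by (simp add: power_divide power_mult_distrib)
  finally show ?thesis .
qed

section \<open>Concentration of Rademacher sums\<close>

lemma half_le_cos: "\<bar>x\<bar> \<le> 1 \<Longrightarrow> 1 / 2 \<le> cos x" for x :: real
  using cos_monotone_0_pi_le[of "\<bar>x\<bar>" "pi / 3"] pi_gt3 by (simp add: cos_60)

lemma half_le_sin: "0 \<le> x \<Longrightarrow> x \<le> 1 \<Longrightarrow> x / 2 \<le> sin x" for x :: real
proof -
  assume x: "0 \<le> x" "x \<le> 1"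
  have "(\<lambda>t. sin t - t / 2) 0 \<le> (\<lambda>t. sin t - t / 2) x"
  proof (rule DERIV_nonneg_imp_nondecreasing[OF x(1)])
    fix t :: real assume t: "0 \<le> t" "t \<le> x"
    have "((\<lambda>t. sin t - t / 2) has_real_derivative (cos t - 1 / 2)) (at t)"
      by (auto intro!: derivative_eq_intros)
    then show "\<exists>y. ((\<lambda>t. sin t - t / 2) has_real_derivative y) (at t) \<and> 0 \<le> y"
      using half_le_cos[of t] t x by (intro exI[of _ "cos t - 1 / 2"]) auto
  qed
  then show ?thesis by simp
qed

text \<open>On this interval \<open>sin x\<close> is at least \<open>x / 2\<close> in modulus, so
  the square of \<open>cos x\<close> is at most \<open>1 - x\<^sup>2 / 4\<close>.\<close>

lemma abs_cos_le_exp: "\<bar>x\<bar> \<le> 1 \<Longrightarrow> \<bar>cos x\<bar> \<le> exp (- x\<^sup>2 / 8)" for x :: real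
proof -
  assume x: "\<bar>x\<bar> \<le> 1"
  have "\<bar>x\<bar> / 2 \<le> sin \<bar>x\<bar>" using x by (intro half_le_sin) auto
  then have "(\<bar>x\<bar> / 2)\<^sup>2 \<le> (sin \<bar>x\<bar>)\<^sup>2" by (intro power_mono) auto
  also have "(sin \<bar>x\<bar>)\<^sup>2 = (sin x)\<^sup>2" by (simp add: abs_if)
  finally have "x\<^sup>2 / 4 \<le> (sin x)\<^sup>2" by (simp add: power_divide)
  then have "(cos x)\<^sup>2 \<le> 1 + - x\<^sup>2 / 4" by (simp add: cos_squared_eq)
  also have "\<dots> \<le> exp (- x\<^sup>2 / 4)" by (rule exp_ge_add_one_self)
  also have "\<dots> = (exp (- x\<^sup>2 / 8))\<^sup>2" by (simp add: power2_eq_square exp_add[symmetric])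
  finally show ?thesis
    by (metis abs_exp_cancel abs_le_square_iff)
qed

text \<open>The Fourier representation of squared \<open>sinc\<close> by a triangular density. Only
  the bounded frequencies \<open>2 * s\<close> occur, so the characteristic function has to be
  estimated near 0 only.\<close>

lemma sinc_square_integral:
  "((\<lambda>s. 2 * (1 - s) * cos (2 * s * y)) has_integral (sinc y)\<^sup>2) {0..1}"
proof (cases "y = 0")
  case True
  have "((\<lambda>s. 2 * (1 - s)) has_integral ((\<lambda>s::real. 2 * s - s\<^sup>2) 1 - (\<lambda>s. 2 * s - s\<^sup>2) 0)) {0..1}"
    by (rule fundamental_theorem_of_calculus)
      (auto intro!: derivative_eq_intros simp: has_real_derivative_iff_has_vector_derivative[symmetric])
  then show ?thesis using True by simp
next
  case False
  let ?F = "\<lambda>s. (1 - s) * sin (2 * s * y) / y - cos (2 * s * y) / (2 * y\<^sup>2)"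
  have "((\<lambda>s. 2 * (1 - s) * cos (2 * s * y)) has_integral (?F 1 - ?F 0)) {0..1}"
  proof (rule fundamental_theorem_of_calculus)
    fix s :: real
    have "(?F has_real_derivative 2 * (1 - s) * cos (2 * s * y)) (at s within {0..1})"
      using False by (auto intro!: derivative_eq_intros simp: power2_eq_square field_simps)
    then show "(?F has_vector_derivative 2 * (1 - s) * cos (2 * s * y)) (at s within {0..1})"
      by (simp add: has_real_derivative_iff_has_vector_derivative)
  qed simp
  also have "?F 1 - ?F 0 = (1 - cos (2 * y)) / (2 * y\<^sup>2)"
    by (simp add: diff_divide_distrib)
  also have "\<dots> = (sinc y)\<^sup>2"
    using False by (simp add: cos_double_sin power_divide)
  finally show ?thesis .
qed

text \<open>A form of Esseen's concentration inequality: the characteristic function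
  \<open>\<Prod>i\<in>J. cos (2 * s * a i)\<close> decays like a Gaussian for \<open>s \<le> 1\<close>.\<close>

lemma cube_avg_sinc_square:
  assumes J: "finite J" and a: "\<And>i. i \<in> J \<Longrightarrow> \<bar>a i\<bar> \<le> 1 / 2"
    and v: "v = (\<Sum>i\<in>J. (a i)\<^sup>2)" "v > 0"
  shows "cube_avg J (\<lambda>y. (sinc ((\<Sum>i\<in>J. a i * y i) - b))\<^sup>2) \<le> 5 / sqrt v"
proof -
  let ?Y = "\<lambda>y. (\<Sum>i\<in>J. a i * y i) - b"
  \<comment> \<open>With this \<open>r\<close> the Gaussian bound for the product of cosines is
    \<open>exp (- (r * s)\<^sup>2)\<close>, which is dominated by
    \<open>1 / (1 + (r * s)\<^sup>2)\<close>, a derivative of an arctangent.\<close>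
  define r where "r = sqrt (v / 2)"
  have r: "r > 0" "r\<^sup>2 = v / 2" using v by (auto simp: r_def)
  have "((\<lambda>s. 2 * (1 - s) * cos (2 * s * ?Y y)) has_integral (sinc (?Y y))\<^sup>2) {0..1}" for y
    by (rule sinc_square_integral[of "?Y y"])
  then have "((\<lambda>s. \<Sum>y\<in>cube_on J. 2 * (1 - s) * cos (2 * s * ?Y y)) has_integral
         (\<Sum>y\<in>cube_on J. (sinc (?Y y))\<^sup>2)) {0..1}"
    by (rule has_integral_sum[OF finite_cube_on[OF J]])
  then have "((\<lambda>s. cube_avg J (\<lambda>y. 2 * (1 - s) * cos (2 * s * ?Y y))) has_integral
         cube_avg J (\<lambda>y. (sinc (?Y y))\<^sup>2)) {0..1}"
    unfolding cube_avg_def by (rule has_integral_divide)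
  moreover have "((\<lambda>s. 2 / (1 + (r * s)\<^sup>2)) has_integral
         (\<lambda>s. 2 / r * arctan (r * s)) 1 - (\<lambda>s. 2 / r * arctan (r * s)) 0) {0..1}"
  proof (rule fundamental_theorem_of_calculus)
    fix s :: real
    have pos: "1 + (r * s)\<^sup>2 > 0" by (rule add_pos_nonneg) auto
    have "((\<lambda>s. 2 / r * arctan (r * s)) has_real_derivative 2 / r * (inverse (1 + (r * s)\<^sup>2) * r)) (at s within {0..1})"
      by (rule DERIV_cmult, rule DERIV_chain2[OF DERIV_arctan], rule DERIV_cmult_Id)
    also have "2 / r * (inverse (1 + (r * s)\<^sup>2) * r) = 2 / (1 + (r * s)\<^sup>2)"
      using r pos by (simp add: field_simps)
    finally show "((\<lambda>s. 2 / r * arctan (r * s)) has_vector_derivative 2 / (1 + (r * s)\<^sup>2)) (at s within {0..1})"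
      by (simp add: has_real_derivative_iff_has_vector_derivative)
  qed simp
  ultimately have "cube_avg J (\<lambda>y. (sinc (?Y y))\<^sup>2) \<le>
      (\<lambda>s. 2 / r * arctan (r * s)) 1 - (\<lambda>s. 2 / r * arctan (r * s)) 0"
  proof (rule has_integral_le)
    fix s :: real assume s: "s \<in> {0..1}"
    have "2 * s * ?Y y = (\<Sum>i\<in>J. (2 * s * a i) * y i) + (- 2 * s * b)" for y
      by (simp add: sum_distrib_left algebra_simps)
    then have "cube_avg J (\<lambda>y. 2 * (1 - s) * cos (2 * s * ?Y y))
        = 2 * (1 - s) * cube_avg J (\<lambda>y. cos ((\<Sum>i\<in>J. (2 * s * a i) * y i) + (- 2 * s * b)))"
      by (simp only: cube_avg_cmult)
    also have "\<dots> = 2 * (1 - s) * (cos (- 2 * s * b) * (\<Prod>i\<in>J. cos (2 * s * a i)))"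
      by (simp only: cube_avg_cos[OF J])
    also have "\<dots> \<le> \<bar>2 * (1 - s) * (cos (- 2 * s * b) * (\<Prod>i\<in>J. cos (2 * s * a i)))\<bar>" by simp
    also have "\<dots> = 2 * (1 - s) * (\<bar>cos (- 2 * s * b)\<bar> * (\<Prod>i\<in>J. \<bar>cos (2 * s * a i)\<bar>))"
      using s by (simp add: abs_mult abs_prod)
    \<comment> \<open>The bound 1/2 on the coefficients keeps all arguments
      \<open>2 * s * a i\<close> in the range of \<open>abs_cos_le_exp\<close>.\<close>
    also have "\<dots> \<le> 2 * 1 * (1 * (\<Prod>i\<in>J. exp (- (2 * s * a i)\<^sup>2 / 8)))"
    proof (intro mult_mono prod_mono conjI abs_cos_le_exp abs_cos_le_one prod_nonneg)
      fix i assume "i \<in> J"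
      then have "\<bar>s\<bar> * \<bar>a i\<bar> \<le> 1 * (1 / 2)" using s a by (intro mult_mono) auto
      then show "\<bar>2 * s * a i\<bar> \<le> 1" by (simp add: abs_mult)
    qed (use s in \<open>auto intro!: mult_nonneg_nonneg prod_nonneg\<close>)
    also have "(\<Prod>i\<in>J. exp (- (2 * s * a i)\<^sup>2 / 8)) = exp (- (s\<^sup>2 * v / 2))"
      by (simp add: exp_sum[OF J, symmetric] v sum_distrib_left sum_divide_distrib sum_negf power_mult_distrib)
    also have "\<dots> = 1 / exp ((r * s)\<^sup>2)"
      by (simp add: exp_minus power_mult_distrib inverse_eq_divide mult.commute r)
    also have "\<dots> \<le> 1 / (1 + (r * s)\<^sup>2)"
      using exp_ge_add_one_self[of "(r * s)\<^sup>2"] by (intro divide_left_mono) (auto intro!: mult_pos_pos add_pos_nonneg)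
    finally show "cube_avg J (\<lambda>y. 2 * (1 - s) * cos (2 * s * ?Y y)) \<le> 2 / (1 + (r * s)\<^sup>2)"
      by simp
  qed
  also have "\<dots> = 2 / r * arctan r" by simp
  also have "\<dots> \<le> 2 / r * (pi / 2)"
    using r arctan_ubound[of r] by (intro mult_left_mono) auto
  also have "\<dots> = pi * sqrt 2 / sqrt v" by (simp add: r_def real_sqrt_divide)
  also have "\<dots> \<le> 5 / sqrt v"
  proof (rule divide_right_mono)
    have "pi * sqrt 2 \<le> 3.2 * 1.5"
      using pi_approx by (intro mult_mono real_le_lsqrt) (auto simp: power2_eq_square)
    then show "pi * sqrt 2 \<le> 5" by simp
  qed (use v in auto)
  finally show ?thesis .
qed

section \<open>Test functions and their Taylor polynomials\<close>

text \<open>\<open>\<phi>\<close> is the restriction to the reals of an entire primitive of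
  \<open>csinc z ^ 4\<close>. The derivative has exponential type 4, whence the constant
  \<open>exp 5\<close> in the Taylor error.\<close>

lemma smooth_step:
  obtains \<phi> :: "real \<Rightarrow> real"
  where "\<And>x. (\<phi> has_real_derivative sinc x ^ 4) (at x)" and "\<phi> 0 = 0"
    and "\<And>a n. \<exists>c::nat\<Rightarrow>real. \<forall>x. \<bar>\<phi> (a + x) - (\<Sum>i\<le>n. c i * x ^ i)\<bar> \<le> (exp 5 * \<bar>x\<bar> / real (Suc n)) ^ Suc n"
proof -
  have "(\<lambda>z. csinc z ^ 4) holomorphic_on UNIV"
    by (intro holomorphic_intros csinc_holomorphic)
  then obtain g where g: "\<And>z. (g has_field_derivative csinc z ^ 4) (at z)"
    using holomorphic_convex_primitive'[of UNIV "\<lambda>z. csinc z ^ 4"] by auto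
  define h where "h = (\<lambda>z. g z - g 0)"
  have h: "(h has_field_derivative csinc z ^ 4) (at z)" for z
    unfolding h_def using g[of z] by (auto intro!: derivative_eq_intros)
  have hol: "h holomorphic_on UNIV"
    using h holomorphic_on_open[OF open_UNIV] by blast
  have bnd: "norm (deriv h z) \<le> exp (4 * \<bar>Im z\<bar>)" for z
    using norm_csinc_power_le[of z 4] by (simp add: DERIV_imp_deriv[OF h])
  define \<phi> where "\<phi> = (\<lambda>x. Re (h (of_real x)))"
  show thesis
  proof
    fix x :: real
    have "((\<lambda>x. h (of_real x)) has_vector_derivative csinc (of_real x) ^ 4) (at x)"
      using h by (rule has_vector_derivative_real_field)
    then have "(\<phi> has_vector_derivative Re (csinc (of_real x) ^ 4)) (at x)"
      unfolding \<phi>_def by (rule bounded_linear.has_vector_derivative[OF bounded_linear_Re])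
    moreover have "Re (csinc (of_real x) ^ 4) = sinc x ^ 4"
      by (simp add: csinc_of_real flip: of_real_power)
    ultimately show "(\<phi> has_real_derivative sinc x ^ 4) (at x)"
      by (simp add: has_real_derivative_iff_has_vector_derivative)
    show "\<phi> 0 = 0" by (simp add: \<phi>_def h_def)
    fix a :: real and n :: nat
    show "\<exists>c::nat\<Rightarrow>real. \<forall>x. \<bar>\<phi> (a + x) - (\<Sum>i\<le>n. c i * x ^ i)\<bar> \<le> (exp 5 * \<bar>x\<bar> / real (Suc n)) ^ Suc n"
      using Taylor_exponential_type_primitive[OF hol bnd, of a n] by (simp add: \<phi>_def)
  qed
qed

lemma sinc_square_Taylor:
  "\<exists>c::nat\<Rightarrow>real. \<forall>x. \<bar>(sinc (a + x))\<^sup>2 - (\<Sum>i\<le>n. c i * x ^ i)\<bar> \<le> (exp 5 * \<bar>x\<bar> / real (Suc n)) ^ Suc n"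
proof -
  have hol: "(\<lambda>z. csinc z ^ 2) holomorphic_on UNIV"
    by (intro holomorphic_intros csinc_holomorphic)
  have bnd: "norm (csinc z ^ 2) \<le> exp (2 * \<bar>Im z\<bar>)" for z
    using norm_csinc_power_le[of z 2] by simp
  have eq: "Re (csinc (of_real y) ^ 2) = (sinc y)\<^sup>2" for y
    by (simp add: csinc_of_real flip: of_real_power)
  obtain c :: "nat \<Rightarrow> real" where c: "\<And>x. \<bar>(sinc (a + x))\<^sup>2 - (\<Sum>i\<le>n. c i * x ^ i)\<bar> \<le> (exp (2 + 1) * \<bar>x\<bar> / real (Suc n)) ^ Suc n"
    using Taylor_exponential_type[OF hol bnd, of a n] unfolding eq by auto
  \<comment> \<open>Type 2 gives \<open>exp 3\<close>; it is weakened to \<open>exp 5\<close> so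
    that both test functions satisfy the same hypothesis of
    \<open>moment_matching_error\<close>.\<close>
  have "(exp (2 + 1) * \<bar>x\<bar> / real (Suc n)) ^ Suc n \<le> (exp 5 * \<bar>x\<bar> / real (Suc n)) ^ Suc n" for x :: real
    by (intro power_mono divide_right_mono mult_right_mono) auto
  then show ?thesis using c by (meson order_trans)
qed

section \<open>Regular linear forms\<close>

text \<open>One squared \<open>sinc\<close> has zeros and cannot dominate anything positive.
  Shifting by \<open>pi / 2\<close> turns the sine into a cosine up to sign, so the two numerators
  add up to 1, while both denominators are at most
  \<open>(\<bar>x\<bar> + 2)\<^sup>2\<close>.\<close>

lemma sinc_squares_ge: "1 / (\<bar>x\<bar> + 2)\<^sup>2 \<le> (sinc x)\<^sup>2 + (sinc (x - pi / 2))\<^sup>2"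
proof -
  have *: "(sin y)\<^sup>2 / (\<bar>x\<bar> + 2)\<^sup>2 \<le> (sinc y)\<^sup>2" if "\<bar>y\<bar> \<le> \<bar>x\<bar> + 2" for y
  proof (cases "y = 0")
    case False
    have "(sin y)\<^sup>2 / (\<bar>x\<bar> + 2)\<^sup>2 \<le> (sin y)\<^sup>2 / y\<^sup>2"
      using False power_mono[OF that, of 2] by (intro divide_left_mono mult_pos_pos) auto
    then show ?thesis using False by (simp add: power_divide)
  qed simp
  have "1 / (\<bar>x\<bar> + 2)\<^sup>2 = (sin x)\<^sup>2 / (\<bar>x\<bar> + 2)\<^sup>2 + (sin (x - pi / 2))\<^sup>2 / (\<bar>x\<bar> + 2)\<^sup>2"
    by (simp add: sin_diff flip: add_divide_distrib)
  also have "\<dots> \<le> (sinc x)\<^sup>2 + (sinc (x - pi / 2))\<^sup>2"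
    using pi_less_4 pi_gt_zero abs_triangle_ineq4[of x "pi / 2"] by (intro add_mono *) auto
  finally show ?thesis .
qed

text \<open>\<open>\<phi>\<close> is odd and nondecreasing, so it suffices to bound
  \<open>1 - \<phi> y / \<phi> N\<close> for \<open>0 \<le> y \<le> N\<close>. Its numerator is the
  integral of \<open>sinc t ^ 4\<close> from \<open>y\<close> to \<open>N\<close>, which decays
  since the integrand is at most \<open>1 / t ^ 4\<close>. Dividing by \<open>\<phi> N\<close> in
  place of a limit at infinity avoids improper integrals.\<close>

lemma smooth_step_sign:
  assumes der: "\<And>x. (\<phi> has_real_derivative sinc x ^ 4) (at x)" and "\<phi> 0 = 0" and N: "N \<ge> 1"
  shows "\<phi> N \<ge> 1 / 16"
    and "\<bar>x\<bar> \<le> N \<Longrightarrow> \<bar>sign_pm x - \<phi> x / \<phi> N\<bar> \<le> 48 * ((sinc x)\<^sup>2 + (sinc (x - pi / 2))\<^sup>2)"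
proof -
  have mono: "\<phi> x \<le> \<phi> y" if "x \<le> y" for x y
    using that by (rule DERIV_nonneg_imp_nondecreasing) (metis der even_numeral zero_le_even_power)
  have odd: "\<phi> (- x) = - \<phi> x" for x
  proof -
    have "((\<lambda>t. \<phi> t + \<phi> (- t)) has_real_derivative 0) (at t)" for t
    proof -
      have "((\<lambda>t. \<phi> (- t)) has_real_derivative sinc (- t) ^ 4 * (- 1)) (at t)"
        by (rule DERIV_chain2[OF der]) (auto intro!: derivative_eq_intros)
      from DERIV_add[OF der[of t] this]
      show ?thesis by (cases "t = 0") auto
    qed
    then have "\<phi> x + \<phi> (- x) = \<phi> 0 + \<phi> (- 0)" by (intro DERIV_isconst_all allI)
    then show ?thesis using \<open>\<phi> 0 = 0\<close> by simp
  qed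
  have "(\<lambda>t. \<phi> t - t / 16) 0 \<le> (\<lambda>t. \<phi> t - t / 16) 1"
  proof (rule DERIV_nonneg_imp_nondecreasing[OF zero_le_one])
    fix t :: real assume t: "0 \<le> t" "t \<le> 1"
    have "1 / 2 \<le> sinc t" using half_le_sin[OF t] t by (auto simp: field_simps)
    then have "(1 / 2) ^ 4 \<le> sinc t ^ 4" by (intro power_mono) auto
    moreover have "((\<lambda>t. \<phi> t - t / 16) has_real_derivative sinc t ^ 4 - 1 / 16) (at t)"
      by (intro DERIV_diff der) (auto intro!: derivative_eq_intros)
    ultimately show "\<exists>y. ((\<lambda>t. \<phi> t - t / 16) has_real_derivative y) (at t) \<and> 0 \<le> y"
      by (intro exI[of _ "sinc t ^ 4 - 1 / 16"]) (auto simp: power_divide)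
  qed
  then have "1 / 16 \<le> \<phi> 1" using \<open>\<phi> 0 = 0\<close> by simp
  also have "\<phi> 1 \<le> \<phi> N" using N by (rule mono)
  finally show N16: "\<phi> N \<ge> 1 / 16" .
  have decay: "\<bar>1 - \<phi> y / \<phi> N\<bar> \<le> 48 / (\<bar>y\<bar> + 2)\<^sup>2" if y: "0 \<le> y" "y \<le> N" for y
  proof -
    have ge: "0 \<le> 1 - \<phi> y / \<phi> N" using mono[OF y(2)] N16 by simp
    show ?thesis
    proof (cases "y \<le> 1")
      case True
      have "(\<bar>y\<bar> + 2)\<^sup>2 \<le> 3\<^sup>2" using True y by (intro power_mono) auto
      then have "1 \<le> 48 / (\<bar>y\<bar> + 2)\<^sup>2" using y by (subst pos_le_divide_eq) auto
      moreover have "\<phi> y / \<phi> N \<ge> 0" using mono[OF y(1)] \<open>\<phi> 0 = 0\<close> N16 by simp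
      ultimately show ?thesis using ge by linarith
    next
      case False
      \<comment> \<open>The added term has derivative \<open>- 1 / t ^ 4\<close>, so
        \<open>?g\<close> decreases, which bounds the integral of \<open>sinc t ^ 4\<close> from
        \<open>y\<close> to \<open>N\<close>.\<close>
      let ?g = "\<lambda>t. \<phi> t + 1 / (3 * t ^ 3)"
      have "?g N \<le> ?g y"
      proof (rule DERIV_nonpos_imp_nonincreasing[OF y(2)])
        fix t assume t: "y \<le> t" "t \<le> N"
        then have t1: "t > 1" using False by simp
        have "((\<lambda>t. 1 / (3 * t ^ 3)) has_real_derivative - (1 / t ^ 4)) (at t)"
          using t1 by (auto intro!: derivative_eq_intros simp: field_simps power2_eq_square eval_nat_numeral)
        from DERIV_add[OF der this] have "(?g has_real_derivative sinc t ^ 4 + - (1 / t ^ 4)) (at t)" .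
        moreover have "sinc t ^ 4 \<le> 1 / t ^ 4"
        proof -
          have "\<bar>sin t\<bar> ^ 4 \<le> 1 ^ 4" by (intro power_mono) auto
          then show ?thesis using t1 by (auto simp: power_divide divide_right_mono)
        qed
        ultimately show "\<exists>d. (?g has_real_derivative d) (at t) \<and> d \<le> 0"
          by (intro exI[of _ "sinc t ^ 4 + - (1 / t ^ 4)"]) simp
      qed
      moreover have "1 / (3 * N ^ 3) \<ge> 0" using N by simp
      ultimately have "\<phi> N - \<phi> y \<le> 1 / (3 * y ^ 3)" by linarith
      also have "\<dots> \<le> 1 / (3 * y\<^sup>2)"
        using False by (intro divide_left_mono mult_left_mono power_increasing mult_pos_pos) auto
      finally have d: "\<phi> N - \<phi> y \<le> 1 / (3 * y\<^sup>2)" .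
      have "1 - \<phi> y / \<phi> N = (\<phi> N - \<phi> y) / \<phi> N" using N16 by (simp add: field_simps)
      also have "\<dots> \<le> (1 / (3 * y\<^sup>2)) / (1 / 16)"
        using d N16 mono[OF y(2)] by (intro frac_le) auto
      \<comment> \<open>The factor 48 is 16 * 3: the 16 comes from
        \<open>\<phi> N \<ge> 1 / 16\<close>, the 3 from completing \<open>3 * y\<^sup>2\<close> to
        \<open>(3 * y)\<^sup>2\<close>, where \<open>3 * y \<ge> y + 2\<close>.\<close>
      also have "\<dots> = 48 / (3 * y)\<^sup>2" by (simp add: power_mult_distrib)
      also have "\<dots> \<le> 48 / (\<bar>y\<bar> + 2)\<^sup>2"
        using False by (intro divide_left_mono power_mono mult_pos_pos) auto
      finally show ?thesis using ge by simp
    qed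
  qed
  assume x: "\<bar>x\<bar> \<le> N"
  have "\<bar>sign_pm x - \<phi> x / \<phi> N\<bar> \<le> 48 * (1 / (\<bar>x\<bar> + 2)\<^sup>2)"
  proof (cases "x \<ge> 0")
    case True then show ?thesis using decay[of x] x by (simp add: sign_pm_def)
  next
    case False
    then have "\<bar>sign_pm x - \<phi> x / \<phi> N\<bar> = \<bar>1 - \<phi> (- x) / \<phi> N\<bar>" by (simp add: sign_pm_def odd)
    then show ?thesis using decay[of "- x"] x False by simp
  qed
  also have "\<dots> \<le> 48 * ((sinc x)\<^sup>2 + (sinc (x - pi / 2))\<^sup>2)"
    using sinc_squares_ge[of x] by simp
  finally show "\<bar>sign_pm x - \<phi> x / \<phi> N\<bar> \<le> 48 * ((sinc x)\<^sup>2 + (sinc (x - pi / 2))\<^sup>2)" .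
qed

section \<open>Comparison by moments\<close>

text \<open>\<open>d\<close> is an unnormalized measure of total mass \<open>c\<close> (the case
  \<open>j = 0\<close> of \<open>mom\<close>), such as a distribution restricted to one head
  assignment. The Taylor polynomial of degree \<open>k - 1\<close> has equal averages on both sides;
  on each side the error is at most a multiple of the moment of order \<open>k\<close>, which is
  also shared.\<close>

lemma moment_matching_error:
  fixes d X :: "'a \<Rightarrow> real"
  assumes d: "\<And>x. x \<in> A \<Longrightarrow> 0 \<le> d x" and J: "finite J"
    and v: "v = (\<Sum>i\<in>J. (a i)\<^sup>2)" "v > 0" and c: "c \<ge> 0"
    and k: "even k" "k > 0" "real k \<ge> exp 13 * v"
    and mom: "\<And>j. j \<le> k \<Longrightarrow> (\<Sum>x\<in>A. d x * X x ^ j) = c * cube_avg J (\<lambda>y. (\<Sum>i\<in>J. a i * y i) ^ j)"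
    and Taylor: "\<exists>p::nat\<Rightarrow>real. \<forall>x. \<bar>f x - (\<Sum>i\<le>k - 1. p i * x ^ i)\<bar> \<le> (exp 5 * \<bar>x\<bar> / real (Suc (k - 1))) ^ Suc (k - 1)"
  shows "\<bar>(\<Sum>x\<in>A. d x * f (X x)) - c * cube_avg J (\<lambda>y. f (\<Sum>i\<in>J. a i * y i))\<bar> \<le> 2 * c * exp (- real k)"
proof -
  let ?Y = "\<lambda>y. \<Sum>i\<in>J. a i * y i"
  let ?M = "cube_avg J (\<lambda>y. ?Y y ^ k)"
  define B where "B = (exp 5 / real k) ^ k"
  obtain p :: "nat \<Rightarrow> real" where p: "\<And>x. \<bar>f x - (\<Sum>i\<le>k - 1. p i * x ^ i)\<bar> \<le> B * x ^ k"
  proof -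
    \<comment> \<open>Since \<open>k\<close> is even, the absolute value disappears and the
      remainder bound is itself a monomial of matched degree.\<close>
    have "(exp 5 * \<bar>x\<bar> / real (Suc (k - 1))) ^ Suc (k - 1) = B * x ^ k" for x :: real
      using k(1,2) by (simp add: B_def power_mult_distrib power_divide power_even_abs)
    then show thesis using Taylor that by auto
  qed
  let ?P = "\<lambda>x. \<Sum>i\<le>k - 1. p i * x ^ i"
  have "(\<Sum>x\<in>A. d x * ?P (X x)) = (\<Sum>i\<le>k - 1. p i * (\<Sum>x\<in>A. d x * X x ^ i))"
    by (simp add: sum_distrib_left sum.swap[of _ A] mult.left_commute)
  also have "\<dots> = (\<Sum>i\<le>k - 1. p i * (c * cube_avg J (\<lambda>y. ?Y y ^ i)))"
    using k by (intro sum.cong) (auto simp: mom)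
  also have "\<dots> = c * cube_avg J (\<lambda>y. ?P (?Y y))"
    by (simp add: cube_avg_sum cube_avg_cmult sum_distrib_left mult.left_commute)
  finally have P: "(\<Sum>x\<in>A. d x * ?P (X x)) = c * cube_avg J (\<lambda>y. ?P (?Y y))" .
  have "\<bar>(\<Sum>x\<in>A. d x * f (X x)) - (\<Sum>x\<in>A. d x * ?P (X x))\<bar> \<le> (\<Sum>x\<in>A. \<bar>d x * (f (X x) - ?P (X x))\<bar>)"
    unfolding sum_subtractf[symmetric] right_diff_distrib[symmetric] by (rule sum_abs)
  also have "\<dots> \<le> (\<Sum>x\<in>A. d x * (B * X x ^ k))"
    using d p by (intro sum_mono) (simp add: abs_mult mult_left_mono)
  also have "\<dots> = B * (c * ?M)"
    by (simp add: mom[OF order_refl, symmetric] sum_distrib_left mult.left_commute)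
  finally have 1: "\<bar>(\<Sum>x\<in>A. d x * f (X x)) - (\<Sum>x\<in>A. d x * ?P (X x))\<bar> \<le> B * (c * ?M)" .
  have "\<bar>cube_avg J (\<lambda>y. f (?Y y)) - cube_avg J (\<lambda>y. ?P (?Y y))\<bar> \<le> cube_avg J (\<lambda>y. \<bar>f (?Y y) - ?P (?Y y)\<bar>)"
    unfolding cube_avg_diff[symmetric] by (rule cube_avg_abs)
  also have "\<dots> \<le> cube_avg J (\<lambda>y. B * ?Y y ^ k)"
    by (intro cube_avg_mono p)
  finally have "\<bar>cube_avg J (\<lambda>y. f (?Y y)) - cube_avg J (\<lambda>y. ?P (?Y y))\<bar> \<le> B * ?M"
    by (simp add: cube_avg_cmult)
  then have "c * \<bar>cube_avg J (\<lambda>y. f (?Y y)) - cube_avg J (\<lambda>y. ?P (?Y y))\<bar> \<le> c * (B * ?M)"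
    using c by (rule mult_left_mono)
  then have 2: "\<bar>c * cube_avg J (\<lambda>y. f (?Y y)) - c * cube_avg J (\<lambda>y. ?P (?Y y))\<bar> \<le> B * (c * ?M)"
    using c by (simp add: abs_mult mult.left_commute flip: right_diff_distrib)
  \<comment> \<open>The factor \<open>B\<close> contributes \<open>exp 10\<close> and the moment
    \<open>exp 1 * v / k\<close>, both to the power \<open>k div 2\<close>. The base
    \<open>exp 11 * v / k\<close> is at most \<open>exp (- 2)\<close> exactly when
    \<open>k \<ge> exp 13 * v\<close>.\<close>
  have "B * ?M \<le> B * (real k ^ k * (exp 1 * v / real k) ^ (k div 2))"
  proof (rule mult_left_mono)
    have "?M \<le> fact k * (exp 1 * v / real k) ^ (k div 2)"
      by (rule cube_avg_even_moment[OF J k(1,2) v])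
    also have "\<dots> \<le> real k ^ k * (exp 1 * v / real k) ^ (k div 2)"
      using v(2) fact_le_power[of k, where 'a=real] by (intro mult_right_mono) auto
    finally show "?M \<le> real k ^ k * (exp 1 * v / real k) ^ (k div 2)" .
  qed (simp add: B_def)
  also have "\<dots> = exp 5 ^ k * (exp 1 * v / real k) ^ (k div 2)"
    using k(2) by (simp add: B_def power_divide)
  also have "exp (5::real) ^ k = (exp 10) ^ (k div 2)"
  proof -
    have "exp (5::real) ^ k = (exp 5 ^ 2) ^ (k div 2)"
      using k(1) by (metis dvd_mult_div_cancel power_mult)
    then show ?thesis by (simp add: exp_of_nat_mult[symmetric])
  qed
  also have "exp 10 ^ (k div 2) * (exp 1 * v / real k) ^ (k div 2) = (exp 11 * v / real k) ^ (k div 2)"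
    by (simp add: power_mult_distrib[symmetric] exp_add[symmetric] mult.assoc[symmetric])
  also have "\<dots> \<le> exp (- 2) ^ (k div 2)"
  proof (rule power_mono)
    have "exp 11 * v * exp 2 \<le> real k" using k(3) by (simp add: mult.commute mult.left_commute exp_add[symmetric])
    then show "exp 11 * v / real k \<le> exp (- 2)"
      using k(2) by (simp add: exp_minus field_simps)
  qed (use v in auto)
  also have "\<dots> = exp (- real k)"
  proof -
    have "real (k div 2) * (- 2) = - real k" using k(1) by auto
    then show ?thesis by (metis exp_of_nat_mult)
  qed
  finally have "c * (B * ?M) \<le> c * exp (- real k)" using c by (intro mult_left_mono)
  then show ?thesis using 1 2 P by (simp add: mult.left_commute)
qed

text \<open>The sign is compared with \<open>F\<close> on both sides, at a cost of 48 times the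
  average of \<open>G\<close>. Moment matching transfers the averages of \<open>F\<close> and
  \<open>G\<close>, and under the uniform distribution that of \<open>G\<close> is small by
  \<open>cube_avg_sinc_square\<close>.\<close>

lemma regular_linear_form:
  fixes d X :: "'a \<Rightarrow> real"
  assumes A: "finite A" and d: "\<And>x. x \<in> A \<Longrightarrow> 0 \<le> d x"
    and J: "finite J" and a: "\<And>i. i \<in> J \<Longrightarrow> \<bar>a i\<bar> \<le> 1 / 2"
    and v: "v = (\<Sum>i\<in>J. (a i)\<^sup>2)" "v > 0" and c: "c \<ge> 0"
    and k: "even k" "k > 0" "real k \<ge> exp 13 * v"
    and mom: "\<And>j. j \<le> k \<Longrightarrow> (\<Sum>x\<in>A. d x * X x ^ j) = c * cube_avg J (\<lambda>y. (\<Sum>i\<in>J. a i * y i) ^ j)"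
  shows "\<bar>(\<Sum>x\<in>A. d x * sign_pm (X x - b)) - c * cube_avg J (\<lambda>y. sign_pm ((\<Sum>i\<in>J. a i * y i) - b))\<bar>
           \<le> c * (1200 / sqrt v)"
proof -
  let ?Y = "\<lambda>y. \<Sum>i\<in>J. a i * y i"
  obtain \<phi> :: "real \<Rightarrow> real" where der: "\<And>x. (\<phi> has_real_derivative sinc x ^ 4) (at x)" and \<phi>0: "\<phi> 0 = 0"
    and \<phi>T: "\<And>a n. \<exists>c::nat\<Rightarrow>real. \<forall>x. \<bar>\<phi> (a + x) - (\<Sum>i\<le>n. c i * x ^ i)\<bar> \<le> (exp 5 * \<bar>x\<bar> / real (Suc n)) ^ Suc n"
    using smooth_step by blast
  \<comment> \<open>All values of both linear forms lie within \<open>N\<close> of \<open>b\<close>,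
    so \<open>smooth_step_sign\<close> applies at every point that occurs.\<close>
  define N where "N = 1 + (\<Sum>x\<in>A. \<bar>X x - b\<bar>) + (\<Sum>y\<in>cube_on J. \<bar>?Y y - b\<bar>)"
  have nonneg: "(\<Sum>x\<in>A. \<bar>X x - b\<bar>) \<ge> 0" "(\<Sum>y\<in>cube_on J. \<bar>?Y y - b\<bar>) \<ge> 0"
    by (auto intro: sum_nonneg)
  then have N1: "N \<ge> 1" by (simp add: N_def)
  have NX: "\<bar>X x - b\<bar> \<le> N" if "x \<in> A" for x
    using member_le_sum[OF that, of "\<lambda>x. \<bar>X x - b\<bar>"] A nonneg unfolding N_def by linarith
  have NY: "\<bar>?Y y - b\<bar> \<le> N" if "y \<in> cube_on J" for y
    using member_le_sum[OF that, of "\<lambda>y. \<bar>?Y y - b\<bar>"] finite_cube_on[OF J] nonneg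
    unfolding N_def by linarith
  note step = smooth_step_sign[OF der \<phi>0 N1]
  define G where "G = (\<lambda>t. (sinc (t - b))\<^sup>2 + (sinc (t - (b + pi / 2)))\<^sup>2)"
  define F where "F = (\<lambda>t. \<phi> (t - b) / \<phi> N)"
  have sF: "\<bar>sign_pm (t - b) - F t\<bar> \<le> 48 * G t" if "\<bar>t - b\<bar> \<le> N" for t
    using step(2)[OF that] unfolding F_def G_def diff_diff_eq .
  define e where "e = exp (- real k)"
  have err: "\<bar>(\<Sum>x\<in>A. d x * f (X x)) - c * cube_avg J (\<lambda>y. f (?Y y))\<bar> \<le> 2 * c * e"
    if "\<exists>p::nat\<Rightarrow>real. \<forall>x. \<bar>f x - (\<Sum>i\<le>k - 1. p i * x ^ i)\<bar> \<le> (exp 5 * \<bar>x\<bar> / real (Suc (k - 1))) ^ Suc (k - 1)" for f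
    unfolding e_def by (rule moment_matching_error[OF _ J v c k _ that]) (use d mom in auto)
  have sinc_err: "\<bar>(\<Sum>x\<in>A. d x * (sinc (X x - t))\<^sup>2) - c * cube_avg J (\<lambda>y. (sinc (?Y y - t))\<^sup>2)\<bar> \<le> 2 * c * e" for t
    using sinc_square_Taylor[of "- t" "k - 1"] unfolding uminus_add_conv_diff
    by (rule err[where f = "\<lambda>u. (sinc (u - t))\<^sup>2"])
  have "\<bar>(\<Sum>x\<in>A. d x * \<phi> (X x - b)) - c * cube_avg J (\<lambda>y. \<phi> (?Y y - b))\<bar> \<le> 2 * c * e"
    using \<phi>T[of "- b" "k - 1"] unfolding uminus_add_conv_diff
    by (rule err[where f = "\<lambda>u. \<phi> (u - b)"])
  then have "\<bar>(\<Sum>x\<in>A. d x * \<phi> (X x - b)) - c * cube_avg J (\<lambda>y. \<phi> (?Y y - b))\<bar> / \<phi> N \<le> (2 * c * e) / (1 / 16)"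
    using step(1) by (intro frac_le) auto
  moreover have "(\<Sum>x\<in>A. d x * F (X x)) - c * cube_avg J (\<lambda>y. F (?Y y))
     = ((\<Sum>x\<in>A. d x * \<phi> (X x - b)) - c * cube_avg J (\<lambda>y. \<phi> (?Y y - b))) / \<phi> N"
    by (simp add: F_def cube_avg_divide sum_divide_distrib diff_divide_distrib)
  ultimately have FF: "\<bar>(\<Sum>x\<in>A. d x * F (X x)) - c * cube_avg J (\<lambda>y. F (?Y y))\<bar> \<le> 32 * (c * e)"
    using step(1) by (simp add: abs_divide)
  have "cube_avg J (\<lambda>y. G (?Y y)) \<le> 10 / sqrt v"
    using cube_avg_sinc_square[OF J a v, of b] cube_avg_sinc_square[OF J a v, of "b + pi / 2"]
    by (simp add: G_def cube_avg_add)
  then have GY: "c * cube_avg J (\<lambda>y. G (?Y y)) \<le> c * (10 / sqrt v)"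
    using c by (rule mult_left_mono)
  have GX: "(\<Sum>x\<in>A. d x * G (X x)) \<le> c * cube_avg J (\<lambda>y. G (?Y y)) + 4 * (c * e)"
    using sinc_err[of b] sinc_err[of "b + pi / 2"]
    by (simp add: G_def cube_avg_add distrib_left sum.distrib)
  have "\<bar>(\<Sum>x\<in>A. d x * sign_pm (X x - b)) - (\<Sum>x\<in>A. d x * F (X x))\<bar> \<le> (\<Sum>x\<in>A. \<bar>d x * (sign_pm (X x - b) - F (X x))\<bar>)"
    unfolding sum_subtractf[symmetric] right_diff_distrib[symmetric] by (rule sum_abs)
  also have "\<dots> \<le> (\<Sum>x\<in>A. d x * (48 * G (X x)))"
    using d NX by (intro sum_mono) (simp add: abs_mult mult_left_mono sF)
  finally have X: "\<bar>(\<Sum>x\<in>A. d x * sign_pm (X x - b)) - (\<Sum>x\<in>A. d x * F (X x))\<bar> \<le> 48 * (\<Sum>x\<in>A. d x * G (X x))"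
    by (simp add: sum_distrib_left mult.left_commute)
  have "\<bar>cube_avg J (\<lambda>y. sign_pm (?Y y - b)) - cube_avg J (\<lambda>y. F (?Y y))\<bar> \<le> cube_avg J (\<lambda>y. \<bar>sign_pm (?Y y - b) - F (?Y y)\<bar>)"
    unfolding cube_avg_diff[symmetric] by (rule cube_avg_abs)
  also have "\<dots> \<le> cube_avg J (\<lambda>y. 48 * G (?Y y))"
    by (intro cube_avg_mono sF NY)
  finally have "c * \<bar>cube_avg J (\<lambda>y. sign_pm (?Y y - b)) - cube_avg J (\<lambda>y. F (?Y y))\<bar> \<le> c * (48 * cube_avg J (\<lambda>y. G (?Y y)))"
    using c unfolding cube_avg_cmult by (rule mult_left_mono)
  then have Y: "\<bar>c * cube_avg J (\<lambda>y. sign_pm (?Y y - b)) - c * cube_avg J (\<lambda>y. F (?Y y))\<bar> \<le> 48 * (c * cube_avg J (\<lambda>y. G (?Y y)))"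
    using c by (simp add: abs_mult mult.left_commute flip: right_diff_distrib)
  have "e \<le> 1 / sqrt v"
  proof -
    have "1 * v \<le> exp 13 * v" using v by (intro mult_right_mono) auto
    then have "v \<le> real k" using k by simp
    also have "\<dots> \<le> (real k)\<^sup>2" using k(2) by (simp add: power2_eq_square)
    finally have "sqrt v \<le> real k" by (intro real_le_lsqrt) auto
    also have "\<dots> \<le> exp (real k)" using exp_ge_add_one_self[of "real k"] by linarith
    finally show ?thesis using v by (simp add: e_def exp_minus field_simps)
  qed
  then have "c * e \<le> c * (1 / sqrt v)" using c by (rule mult_left_mono)
  \<comment> \<open>In units of \<open>c / sqrt v\<close>: 48 * (10 + 4) for the signs under
    \<open>d\<close>, 32 for \<open>F\<close>, and 48 * 10 for the signs under the uniform
    distribution.\<close>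
  then have "\<bar>(\<Sum>x\<in>A. d x * sign_pm (X x - b)) - c * cube_avg J (\<lambda>y. sign_pm (?Y y - b))\<bar> \<le> 1184 * (c * (1 / sqrt v))"
    using X Y FF GX GY by (simp add: abs_le_iff)
  also have "\<dots> \<le> 1200 * (c * (1 / sqrt v))"
    using c v by (intro mult_right_mono) auto
  finally show ?thesis by (simp add: mult.commute)
qed

section \<open>Head and tail\<close>

lemma cube_on_Un_restrict: "x \<in> cube_on T \<Longrightarrow> S \<subseteq> T \<Longrightarrow> restrict x S \<in> cube_on S"
  by (auto simp: cube_on_def)

text \<open>Fubini for disjoint coordinate sets, by induction on \<open>J\<close>. For empty
  \<open>J\<close> the merged point is \<open>z\<close> itself because points of
  \<open>cube_on H\<close> are extensional.\<close>

lemma cube_avg_Un: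
  assumes "finite H" "finite J" "H \<inter> J = {}"
  shows "cube_avg (H \<union> J) g = cube_avg H (\<lambda>z. cube_avg J (\<lambda>y. g (\<lambda>i. if i \<in> H then z i else y i)))"
  using assms(2,3)
proof (induction J arbitrary: g)
  case empty
  have "(\<lambda>i. if i \<in> H then z i else undefined) = z" if "z \<in> cube_on H" for z
    using that by (auto simp: cube_on_def fun_eq_iff PiE_def extensional_def)
  then show ?case by (auto simp: cube_avg_empty intro!: cube_avg_cong)
next
  case (insert i J)
  have upd: "(\<lambda>j. if j \<in> H then z j else y j)(i := v) = (\<lambda>j. if j \<in> H then z j else (y(i := v)) j)"
    for z y :: "nat \<Rightarrow> real" and v
    using insert.prems by auto
  show ?case
    using insert assms(1) by (simp add: cube_avg_insert upd del: fun_upd_apply)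
qed

lemma cube_avg_restrict:
  assumes "finite T" "S \<subseteq> T"
  shows "cube_avg T (\<lambda>x. g (restrict x S)) = cube_avg S g"
proof -
  have fin: "finite S" "finite (T - S)" using assms finite_subset by auto
  have U: "S \<union> (T - S) = T" using assms by auto
  have "cube_avg T (\<lambda>x. g (restrict x S))
      = cube_avg S (\<lambda>z. cube_avg (T - S) (\<lambda>y. g (restrict (\<lambda>i. if i \<in> S then z i else y i) S)))"
    by (rule cube_avg_Un[OF fin Diff_disjoint, unfolded U])
  also have "\<dots> = cube_avg S g"
  proof (rule cube_avg_cong)
    fix z assume "z \<in> cube_on S"
    then have "restrict (\<lambda>i. if i \<in> S then z i else y i) S = z" for y
      by (auto simp: cube_on_def fun_eq_iff PiE_def extensional_def)
    then show "cube_avg (T - S) (\<lambda>y. g (restrict (\<lambda>i. if i \<in> S then z i else y i) S)) = g z"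
      using fin by (simp add: cube_avg_const)
  qed
  finally show ?thesis .
qed

section \<open>Expectations under k-wise independence\<close>

lemma expectation_on_cube:
  assumes "distribution_on_cube n D"
  shows "measure_pmf.expectation D g = (\<Sum>x\<in>cube n. pmf D x * g x)"
  using assms finite_cube_on[of "{..<n}"]
  by (subst integral_measure_pmf_real[of "cube n"]) (auto simp: distribution_on_cube_def mult.commute)

lemma expectation_uniform:
  "finite J \<Longrightarrow> measure_pmf.expectation (pmf_of_set (cube_on J)) g = cube_avg J g"
  by (simp add: integral_pmf_of_set cube_on_nonempty finite_cube_on cube_avg_def card_cube_on)

lemma k_wise_junta:
  assumes "distribution_on_cube n D" "k_wise_independent n k D" "S \<subseteq> {..<n}" "card S \<le> k"
  shows "(\<Sum>x\<in>cube n. pmf D x * g (restrict x S)) = cube_avg S g"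
proof -
  have "(\<Sum>x\<in>cube n. pmf D x * g (restrict x S)) = measure_pmf.expectation D (\<lambda>x. g (restrict x S))"
    by (rule expectation_on_cube[OF assms(1), symmetric])
  also have "\<dots> = measure_pmf.expectation (map_pmf (\<lambda>x. restrict x S) D) g" by simp
  also have "\<dots> = cube_avg S g"
    using assms finite_subset[of S "{..<n}"] by (simp add: k_wise_independent_def expectation_uniform)
  finally show ?thesis .
qed

text \<open>Each induction step peels off one factor of the power and absorbs its coordinate
  \<open>x i\<close> into \<open>g\<close>, so that \<open>S\<close> gains at most one element while
  \<open>j\<close> drops by one. The free function \<open>g\<close> also admits indicators of head
  assignments.\<close>

lemma k_wise_moment:
  assumes D: "distribution_on_cube n D" "k_wise_independent n k D" and J: "J \<subseteq> {..<n}"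
  shows "S \<subseteq> {..<n} \<Longrightarrow> card S + j \<le> k \<Longrightarrow>
    (\<Sum>x\<in>cube n. pmf D x * (g (restrict x S) * (\<Sum>i\<in>J. a i * x i) ^ j))
      = cube_avg {..<n} (\<lambda>x. g (restrict x S) * (\<Sum>i\<in>J. a i * x i) ^ j)"
proof (induction j arbitrary: S g)
  case 0
  then have "(\<Sum>x\<in>cube n. pmf D x * g (restrict x S)) = cube_avg {..<n} (\<lambda>x. g (restrict x S))"
    using k_wise_junta[OF D, of S g] cube_avg_restrict[of "{..<n}" S g] by (simp only: finite_lessThan)
  then show ?case by (simp only: power_0 mult_1_right)
next
  case (Suc j)
  let ?X = "\<lambda>x. \<Sum>i\<in>J. a i * x i"
  have expand: "g (restrict x S) * ?X x ^ Suc j = (\<Sum>i\<in>J. a i * ((g (restrict x S) * x i) * ?X x ^ j))" for x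
  proof -
    have "g (restrict x S) * ?X x ^ Suc j = ?X x * (g (restrict x S) * ?X x ^ j)" by simp
    also have "\<dots> = (\<Sum>i\<in>J. a i * x i * (g (restrict x S) * ?X x ^ j))" by (rule sum_distrib_right)
    also have "\<dots> = (\<Sum>i\<in>J. a i * ((g (restrict x S) * x i) * ?X x ^ j))"
      by (intro sum.cong) (auto simp only: mult.assoc mult.left_commute)
    finally show ?thesis .
  qed
  have step: "(\<Sum>x\<in>cube n. pmf D x * ((g (restrict x S) * x i) * ?X x ^ j))
      = cube_avg {..<n} (\<lambda>x. (g (restrict x S) * x i) * ?X x ^ j)" if "i \<in> J" for i
  proof -
    have "card (insert i S) \<le> Suc (card S)" by (rule card_insert_le_m1) auto
    then have "insert i S \<subseteq> {..<n}" "card (insert i S) + j \<le> k"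
      using that J Suc.prems by auto
    moreover have "restrict (restrict x (insert i S)) S = restrict x S" "restrict x (insert i S) i = x i"
      for x :: "nat \<Rightarrow> real" by auto
    ultimately show ?thesis
      using Suc.IH[of "insert i S" "\<lambda>u. g (restrict u S) * u i"] by (simp only:)
  qed
  have "(\<Sum>x\<in>cube n. pmf D x * (g (restrict x S) * ?X x ^ Suc j))
      = (\<Sum>i\<in>J. a i * (\<Sum>x\<in>cube n. pmf D x * ((g (restrict x S) * x i) * ?X x ^ j)))"
    unfolding expand by (simp add: sum_distrib_left sum.swap[of _ "cube n"] mult.left_commute)
  also have "\<dots> = (\<Sum>i\<in>J. a i * cube_avg {..<n} (\<lambda>x. (g (restrict x S) * x i) * ?X x ^ j))"
    using step by simp
  also have "\<dots> = cube_avg {..<n} (\<lambda>x. g (restrict x S) * ?X x ^ Suc j)"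
    unfolding expand cube_avg_sum cube_avg_cmult ..
  finally show ?case .
qed

lemma linear_form_head_tail:
  fixes w :: "nat \<Rightarrow> real"
  assumes "H \<subseteq> {..<n}"
  shows "(\<Sum>i<n. w i * x i) = (\<Sum>i\<in>H. w i * restrict x H i) + (\<Sum>i\<in>{..<n} - H. w i * x i)"
proof -
  have "(\<Sum>i<n. w i * x i) = (\<Sum>i\<in>H. w i * x i) + (\<Sum>i\<in>{..<n} - H. w i * x i)"
    using sum.subset_diff[OF assms, of "\<lambda>i. w i * x i"] by simp
  then show ?thesis by simp
qed

lemma sign_pm_mult: "t > 0 \<Longrightarrow> sign_pm (t * u) = sign_pm u"
  by (simp add: sign_pm_def zero_le_mult_iff)

text \<open>Condition on the assignment \<open>z\<close> of the head. Moments of the tail up to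
  order \<open>k0\<close> on each fiber involve at most \<open>card H + k0\<close> coordinates, so
  they agree with the uniform ones and \<open>regular_linear_form\<close> applies. The fiber errors
  are proportional to the masses, which sum to 1.\<close>

lemma fools_regular_tail:
  fixes w :: "nat \<Rightarrow> real"
  assumes D: "distribution_on_cube n D" "k_wise_independent n k D" and H: "H \<subseteq> {..<n}"
    and \<delta>: "\<delta> > 0"
    and reg: "\<And>i. i \<in> {..<n} - H \<Longrightarrow> \<bar>w i\<bar> \<le> \<delta> * sqrt (\<Sum>j\<in>{..<n} - H. (w j)\<^sup>2)"
    and k0: "even k0" "k0 > 0" "real k0 \<ge> exp 13 / (4 * \<delta>\<^sup>2)" "card H + k0 \<le> k"
  shows "\<bar>(\<Sum>x\<in>cube n. pmf D x * sign_pm ((\<Sum>i<n. w i * x i) - \<theta>))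
      - cube_avg {..<n} (\<lambda>x. sign_pm ((\<Sum>i<n. w i * x i) - \<theta>))\<bar> \<le> 2400 * \<delta>"
proof -
  define J where "J = {..<n} - H"
  define V where "V = (\<Sum>j\<in>J. (w j)\<^sup>2)"
  let ?h = "\<lambda>x. sign_pm ((\<Sum>i<n. w i * x i) - \<theta>)"
  have fin: "finite H" "finite J" using H finite_subset by (auto simp: J_def)
  have HJ: "H \<union> J = {..<n}" "H \<inter> J = {}" using H by (auto simp: J_def)
  have split: "(\<Sum>i<n. w i * x i) = (\<Sum>i\<in>H. w i * restrict x H i) + (\<Sum>i\<in>J. w i * x i)" for x
    unfolding J_def using H by (rule linear_form_head_tail)
  have "V \<ge> 0" by (simp add: V_def sum_nonneg)
  then consider "V = 0" | "V > 0" by linarith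
  then show ?thesis
  proof cases
    \<comment> \<open>A tail of norm 0 cannot be rescaled, but then the halfspace depends on the
      head alone.\<close>
    case 1
    then have "w i = 0" if "i \<in> J" for i using reg[of i] that by (simp add: J_def V_def)
    then have h: "?h x = (\<lambda>z. sign_pm ((\<Sum>i\<in>H. w i * z i) - \<theta>)) (restrict x H)" for x
      unfolding split by simp
    have "card H \<le> k" using k0(4) by simp
    then have "(\<Sum>x\<in>cube n. pmf D x * ?h x) = cube_avg {..<n} ?h"
      unfolding h by (rule k_wise_junta[OF D H, THEN trans])
        (rule cube_avg_restrict[OF finite_lessThan H, symmetric])
    then have "\<bar>(\<Sum>x\<in>cube n. pmf D x * ?h x) - cube_avg {..<n} ?h\<bar> = 0" by (simp only: diff_self abs_zero)
    then show ?thesis using \<delta> by linarith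
  next
    case 2
    \<comment> \<open>Rescaling to norm \<open>1 / (2 * \<delta>)\<close> makes every regular weight
      at most 1/2 and turns \<open>1200 / sqrt v\<close> into
      \<open>2400 * \<delta>\<close>.\<close>
    define t where "t = 1 / (2 * \<delta> * sqrt V)"
    have t: "t > 0" "t\<^sup>2 * V = 1 / (4 * \<delta>\<^sup>2)" using 2 \<delta> by (auto simp: t_def power_divide power_mult_distrib)
    \<comment> \<open>\<open>c\<close> is the mass of one fiber, and \<open>b z\<close> is the
      rescaled threshold that remains for the tail.\<close>
    define c :: real where "c = 1 / 2 ^ card H"
    define b where "b = (\<lambda>z. t * (\<theta> - (\<Sum>i\<in>H. w i * z i)))"
    let ?X = "\<lambda>x. \<Sum>i\<in>J. (t * w i) * x i"
    have X: "?X x = t * (\<Sum>i\<in>J. w i * x i)" for x by (simp add: sum_distrib_left mult.assoc)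
    have h: "?h x = sign_pm (?X x - b (restrict x H))" for x
    proof -
      have "?X x - b (restrict x H) = t * ((\<Sum>i<n. w i * x i) - \<theta>)"
        unfolding split X b_def by (simp add: algebra_simps)
      then show ?thesis using t by (simp add: sign_pm_mult)
    qed
    have merge: "restrict (\<lambda>i. if i \<in> H then z i else y i) H = z" "?X (\<lambda>i. if i \<in> H then z i else y i) = ?X y"
      if "z \<in> cube_on H" for z y
      using that HJ by (auto simp: cube_on_def fun_eq_iff PiE_def extensional_def intro!: sum.cong)
    have fiber: "\<bar>(\<Sum>x | x \<in> cube n \<and> restrict x H = z. pmf D x * ?h x)
        - c * cube_avg J (\<lambda>y. sign_pm (?X y - b z))\<bar> \<le> c * (2400 * \<delta>)" if z: "z \<in> cube_on H" for z
    proof -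
      let ?A = "{x. x \<in> cube n \<and> restrict x H = z}"
      have "\<bar>(\<Sum>x\<in>?A. pmf D x * sign_pm (?X x - b z)) - c * cube_avg J (\<lambda>y. sign_pm (?X y - b z))\<bar>
          \<le> c * (1200 / sqrt (t\<^sup>2 * V))"
      proof (rule regular_linear_form)
        show "finite ?A" using finite_cube_on[of "{..<n}"] by simp
        show "\<bar>t * w i\<bar> \<le> 1 / 2" if "i \<in> J" for i
        proof -
          have "\<bar>w i\<bar> \<le> \<delta> * sqrt V" using reg[of i] that by (simp add: J_def V_def)
          then have "t * \<bar>w i\<bar> \<le> t * (\<delta> * sqrt V)" using t by (intro mult_left_mono) auto
          also have "\<dots> = 1 / 2" using 2 \<delta> by (simp add: t_def)
          finally show ?thesis using t by (simp add: abs_mult)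
        qed
        show "t\<^sup>2 * V = (\<Sum>i\<in>J. (t * w i)\<^sup>2)"
          by (simp add: V_def sum_distrib_left power_mult_distrib)
        show "t\<^sup>2 * V > 0" using t(1) 2 by simp
        show "real k0 \<ge> exp 13 * (t\<^sup>2 * V)" using k0(3) t(2) by simp
        fix j assume j: "j \<le> k0"
        have "(\<Sum>x\<in>?A. pmf D x * ?X x ^ j) = (\<Sum>x\<in>cube n. pmf D x * (of_bool (restrict x H = z) * ?X x ^ j))"
          using finite_cube_on[of "{..<n}"] by (intro sum.mono_neutral_cong_left) auto
        also have "\<dots> = cube_avg {..<n} (\<lambda>x. of_bool (restrict x H = z) * ?X x ^ j)"
          using j k0(4) by (intro k_wise_moment[OF D _ H]) (auto simp: J_def)
        also have "\<dots> = cube_avg H (\<lambda>z'. cube_avg J (\<lambda>y. of_bool (z' = z) * ?X y ^ j))"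
          unfolding HJ(1)[symmetric] cube_avg_Un[OF fin HJ(2)] by (intro cube_avg_cong) (simp add: merge)
        also have "\<dots> = c * cube_avg J (\<lambda>y. ?X y ^ j)"
          using z finite_cube_on[OF fin(1)]
          by (simp add: cube_avg_cmult c_def) (simp add: cube_avg_def of_bool_def if_distrib if_distribR sum.delta cong: if_cong)
        finally show "(\<Sum>x\<in>?A. pmf D x * ?X x ^ j) = c * cube_avg J (\<lambda>y. ?X y ^ j)" .
      qed (use k0 fin in \<open>auto simp: c_def\<close>)
      also have "1200 / sqrt (t\<^sup>2 * V) = 2400 * \<delta>"
        using \<delta> by (simp add: t(2) real_sqrt_divide real_sqrt_mult)
      also have "(\<Sum>x\<in>?A. pmf D x * sign_pm (?X x - b z)) = (\<Sum>x\<in>?A. pmf D x * ?h x)"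
        unfolding h by (intro sum.cong) auto
      finally show ?thesis .
    qed
    have "(\<Sum>x\<in>cube n. pmf D x * ?h x) = (\<Sum>z\<in>cube_on H. \<Sum>x | x \<in> cube n \<and> restrict x H = z. pmf D x * ?h x)"
      using cube_on_Un_restrict[OF _ H] fin by (intro sum.group[symmetric] finite_cube_on) auto
    moreover have "cube_avg {..<n} ?h = (\<Sum>z\<in>cube_on H. c * cube_avg J (\<lambda>y. sign_pm (?X y - b z)))"
    proof -
      have "cube_avg {..<n} ?h = cube_avg H (\<lambda>z. cube_avg J (\<lambda>y. sign_pm (?X y - b z)))"
        unfolding h unfolding HJ(1)[symmetric] cube_avg_Un[OF fin HJ(2)] by (intro cube_avg_cong) (simp add: merge)
      then show ?thesis by (simp add: cube_avg_def[of H] c_def sum_divide_distrib)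
    qed
    ultimately have "\<bar>(\<Sum>x\<in>cube n. pmf D x * ?h x) - cube_avg {..<n} ?h\<bar>
       \<le> (\<Sum>z\<in>cube_on H. \<bar>(\<Sum>x | x \<in> cube n \<and> restrict x H = z. pmf D x * ?h x)
          - c * cube_avg J (\<lambda>y. sign_pm (?X y - b z))\<bar>)"
      by (simp only: sum_subtractf[symmetric] sum_abs)
    also have "\<dots> \<le> (\<Sum>z\<in>cube_on H. c * (2400 * \<delta>))" by (intro sum_mono fiber)
    also have "\<dots> = 2400 * \<delta>" using fin by (simp add: card_cube_on c_def)
    finally show ?thesis .
  qed
qed

section \<open>Separated heads\<close>

text \<open>Equivalently, the sums of distinct sign assignments are more than
  \<open>2 * \<rho>\<close> apart. The form with a center \<open>t\<close> can be applied directly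
  to a threshold.\<close>

definition separated :: "(nat \<Rightarrow> real) \<Rightarrow> nat set \<Rightarrow> real \<Rightarrow> bool" where
  "separated w I \<rho> \<longleftrightarrow> (\<forall>t. \<forall>y\<in>cube_on I. \<forall>y'\<in>cube_on I.
     \<bar>(\<Sum>i\<in>I. w i * y i) - t\<bar> \<le> \<rho> \<longrightarrow> \<bar>(\<Sum>i\<in>I. w i * y' i) - t\<bar> \<le> \<rho> \<longrightarrow> y = y')"

text \<open>Dropping coordinate \<open>i\<close> moves a sum by \<open>\<bar>w i\<bar>\<close>, so
  both partial sums stay within \<open>3 / 2 * \<bar>w i\<bar> \<le> \<rho>\<close> of
  \<open>t\<close> and the assignments agree on \<open>I\<close>. Differing at \<open>i\<close>
  would then put the sums \<open>2 * \<bar>w i\<bar>\<close> apart.\<close>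

lemma separated_insert:
  assumes sep: "separated w I \<rho>" and "finite I" "i \<notin> I" and w: "w i \<noteq> 0" "3 / 2 * \<bar>w i\<bar> \<le> \<rho>"
  shows "separated w (insert i I) (\<bar>w i\<bar> / 2)"
  unfolding separated_def
proof (intro allI ballI impI)
  fix t y y'
  assume y: "y \<in> cube_on (insert i I)" "y' \<in> cube_on (insert i I)"
    and le: "\<bar>(\<Sum>j\<in>insert i I. w j * y j) - t\<bar> \<le> \<bar>w i\<bar> / 2" "\<bar>(\<Sum>j\<in>insert i I. w j * y' j) - t\<bar> \<le> \<bar>w i\<bar> / 2"
  have pm: "y i = -1 \<or> y i = 1" "y' i = -1 \<or> y' i = 1" using y by (auto simp: cube_on_def PiE_iff)
  have S: "(\<Sum>j\<in>insert i I. w j * x j) = w i * x i + (\<Sum>j\<in>I. w j * restrict x I j)" for x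
    using assms(2,3) by simp
  have "restrict y I = restrict y' I"
  proof -
    have "restrict y I \<in> cube_on I" "restrict y' I \<in> cube_on I"
      using y cube_on_Un_restrict by (meson subset_insertI)+
    moreover have "\<bar>w i * y i\<bar> = \<bar>w i\<bar>" "\<bar>w i * y' i\<bar> = \<bar>w i\<bar>" using pm by (auto simp: abs_mult)
    then have "\<bar>(\<Sum>j\<in>I. w j * restrict y I j) - t\<bar> \<le> \<rho>" "\<bar>(\<Sum>j\<in>I. w j * restrict y' I j) - t\<bar> \<le> \<rho>"
      using le w(2) unfolding S by linarith+
    ultimately show ?thesis using sep unfolding separated_def by blast
  qed
  moreover from this have "y i = y' i"
    using le pm w(1) unfolding S by (auto simp: abs_if split: if_splits)
  ultimately show "y = y'"
    using y unfolding cube_on_def by (intro PiE_ext[OF y[unfolded cube_on_def]]) (metis insert_iff restrict_apply')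
qed

text \<open>Fixing the coordinates outside \<open>I\<close> only shifts the center, and then at most
  one of the \<open>2 ^ card I\<close> assignments comes within \<open>\<rho>\<close> of it.\<close>

lemma cube_avg_separated:
  assumes "finite H" "I \<subseteq> H" "separated w I \<rho>"
  shows "cube_avg H (\<lambda>z. of_bool (\<bar>(\<Sum>i\<in>H. w i * z i) - \<theta>\<bar> \<le> \<rho>)) \<le> 1 / 2 ^ card I"
proof -
  let ?K = "H - I"
  have fin: "finite ?K" "finite I" "?K \<inter> I = {}" and H: "H = ?K \<union> I" using assms finite_subset by auto
  let ?m = "\<lambda>z y i. if i \<in> ?K then z i else y i :: real"
  let ?g = "\<lambda>z. of_bool (\<bar>(\<Sum>i\<in>H. w i * z i) - \<theta>\<bar> \<le> \<rho>) :: real"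
  have sum_m: "(\<Sum>i\<in>H. w i * ?m z y i) = (\<Sum>i\<in>?K. w i * z i) + (\<Sum>i\<in>I. w i * y i)" for z y
    by (subst H, subst sum.union_disjoint[OF fin]) (intro arg_cong2[where f = "(+)"] sum.cong, auto)
  have "cube_avg I (\<lambda>y. ?g (?m z y)) \<le> 1 / 2 ^ card I" for z
  proof -
    let ?B = "{y \<in> cube_on I. \<bar>(\<Sum>i\<in>H. w i * ?m z y i) - \<theta>\<bar> \<le> \<rho>}"
    have finB: "finite ?B" using finite_cube_on[OF fin(2)] by simp
    have "y = y'" if "y \<in> ?B" "y' \<in> ?B" for y y'
      using that assms(3)[unfolded separated_def, rule_format, of y y' "\<theta> - (\<Sum>i\<in>?K. w i * z i)"]
      unfolding sum_m by (simp add: algebra_simps)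
    then have "card ?B \<le> 1" using card_le_Suc0_iff_eq[OF finB] by auto
    moreover have "(\<Sum>y\<in>cube_on I. ?g (?m z y)) = real (card ?B)"
      using finite_cube_on[OF fin(2)] by (simp add: of_bool_def sum.If_cases Int_def)
    ultimately show ?thesis by (simp add: cube_avg_def divide_right_mono)
  qed
  then have "cube_avg ?K (\<lambda>z. cube_avg I (\<lambda>y. ?g (?m z y))) \<le> cube_avg ?K (\<lambda>z. 1 / 2 ^ card I)"
    by (intro cube_avg_mono)
  moreover have "cube_avg H ?g = cube_avg ?K (\<lambda>z. cube_avg I (\<lambda>y. ?g (?m z y)))"
    using cube_avg_Un[OF fin, of ?g] H by simp
  ultimately show ?thesis using fin by (simp add: cube_avg_const)
qed

text \<open>The sign of the head sum alone has the same expectation under both distributions. It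
  differs from \<open>h\<close> only if the head sum is within \<open>\<rho>\<close> of \<theta> or
  the tail is at least \<open>\<rho>\<close> in modulus. The first event depends on the head only,
  the second is controlled by a second moment; each distribution pays once.\<close>

lemma fools_separated_head:
  fixes w :: "nat \<Rightarrow> real"
  assumes D: "distribution_on_cube n D" "k_wise_independent n k D" and H: "H \<subseteq> {..<n}" "card H \<le> k" and k: "2 \<le> k"
    and I: "I \<subseteq> H" "separated w I \<rho>" and \<rho>: "\<rho> > 0"
    and V: "(\<Sum>i\<in>{..<n} - H. (w i)\<^sup>2) \<le> \<eta>\<^sup>2 * \<rho>\<^sup>2"
  shows "\<bar>(\<Sum>x\<in>cube n. pmf D x * sign_pm ((\<Sum>i<n. w i * x i) - \<theta>))
      - cube_avg {..<n} (\<lambda>x. sign_pm ((\<Sum>i<n. w i * x i) - \<theta>))\<bar> \<le> 4 * (1 / 2 ^ card I + \<eta>\<^sup>2)"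
proof -
  define J where "J = {..<n} - H"
  have fin: "finite H" "finite J" "J \<subseteq> {..<n}" using H finite_subset by (auto simp: J_def)
  let ?h = "\<lambda>x. sign_pm ((\<Sum>i<n. w i * x i) - \<theta>)"
  let ?s = "\<lambda>z. sign_pm ((\<Sum>i\<in>H. w i * z i) - \<theta>)"
  let ?bad = "\<lambda>z. of_bool (\<bar>(\<Sum>i\<in>H. w i * z i) - \<theta>\<bar> \<le> \<rho>) :: real"
  let ?R = "\<lambda>x. \<Sum>i\<in>J. w i * x i"
  define b where "b = cube_avg H ?bad"
  have b: "b \<le> 1 / 2 ^ card I" unfolding b_def by (rule cube_avg_separated[OF fin(1) I])
  have split: "(\<Sum>i<n. w i * x i) = (\<Sum>i\<in>H. w i * restrict x H i) + ?R x" for x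
    unfolding J_def using H(1) by (rule linear_form_head_tail)
  have pt: "\<bar>?h x - ?s (restrict x H)\<bar> \<le> 2 * ?bad (restrict x H) + 2 / \<rho>\<^sup>2 * (?R x)\<^sup>2" for x
  proof (cases "?h x = ?s (restrict x H) \<or> ?bad (restrict x H) = 1")
    case True
    then show ?thesis by (auto simp: sign_pm_def)
  next
    case False
    then have "\<bar>(\<Sum>i\<in>H. w i * restrict x H i) - \<theta>\<bar> > \<rho>" by (simp add: not_le)
    with False have "\<rho> \<le> \<bar>?R x\<bar>" unfolding split sign_pm_def by (auto split: if_splits)
    then have "\<rho>\<^sup>2 \<le> (?R x)\<^sup>2" using \<rho> by (metis abs_le_square_iff abs_of_pos)
    then have "2 \<le> 2 / \<rho>\<^sup>2 * (?R x)\<^sup>2" using \<rho> by (simp add: field_simps)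
    moreover have "\<bar>?h x - ?s (restrict x H)\<bar> \<le> 2" by (auto simp: sign_pm_def)
    ultimately show ?thesis by simp
  qed
  have R: "cube_avg {..<n} (\<lambda>x. (?R x)\<^sup>2) = (\<Sum>i\<in>J. (w i)\<^sup>2)"
  proof -
    have "cube_avg {..<n} (\<lambda>x. (?R x)\<^sup>2) = cube_avg {..<n} (\<lambda>x. (?R (restrict x J))\<^sup>2)"
      by (intro cube_avg_cong) simp
    then show ?thesis using fin cube_avg_restrict[of "{..<n}" J "\<lambda>y. (?R y)\<^sup>2"] by (simp add: cube_avg_square)
  qed
  have RD: "(\<Sum>x\<in>cube n. pmf D x * (?R x)\<^sup>2) = (\<Sum>i\<in>J. (w i)\<^sup>2)"
    using k_wise_moment[OF D fin(3), of "{}" 2 "\<lambda>_. 1" w] k R by simp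
  let ?E = "2 * b + 2 / \<rho>\<^sup>2 * (\<Sum>i\<in>J. (w i)\<^sup>2)"
  have "\<bar>(\<Sum>x\<in>cube n. pmf D x * ?h x) - (\<Sum>x\<in>cube n. pmf D x * ?s (restrict x H))\<bar>
      \<le> (\<Sum>x\<in>cube n. \<bar>pmf D x * (?h x - ?s (restrict x H))\<bar>)"
    unfolding sum_subtractf[symmetric] right_diff_distrib[symmetric] by (rule sum_abs)
  also have "\<dots> \<le> (\<Sum>x\<in>cube n. pmf D x * (2 * ?bad (restrict x H) + 2 / \<rho>\<^sup>2 * (?R x)\<^sup>2))"
    unfolding abs_mult using pt by (intro sum_mono mult_mono) auto
  also have "\<dots> = 2 * (\<Sum>x\<in>cube n. pmf D x * ?bad (restrict x H)) + 2 / \<rho>\<^sup>2 * (\<Sum>x\<in>cube n. pmf D x * (?R x)\<^sup>2)"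
    by (simp only: distrib_left sum.distrib sum_distrib_left mult.left_commute)
  also have "\<dots> = ?E"
    unfolding RD b_def using k_wise_junta[OF D H(1,2), of ?bad] by simp
  finally have 1: "\<bar>(\<Sum>x\<in>cube n. pmf D x * ?h x) - cube_avg H ?s\<bar> \<le> ?E"
    using k_wise_junta[OF D H(1,2), of ?s] by simp
  have "\<bar>cube_avg {..<n} ?h - cube_avg {..<n} (\<lambda>x. ?s (restrict x H))\<bar> \<le> cube_avg {..<n} (\<lambda>x. \<bar>?h x - ?s (restrict x H)\<bar>)"
    unfolding cube_avg_diff[symmetric] by (rule cube_avg_abs)
  also have "\<dots> \<le> cube_avg {..<n} (\<lambda>x. 2 * ?bad (restrict x H) + 2 / \<rho>\<^sup>2 * (?R x)\<^sup>2)"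
    by (intro cube_avg_mono pt)
  also have "\<dots> = ?E"
    unfolding cube_avg_add cube_avg_cmult R b_def using cube_avg_restrict[of "{..<n}" H ?bad] H(1) by simp
  finally have 2: "\<bar>cube_avg {..<n} ?h - cube_avg H ?s\<bar> \<le> ?E"
    using cube_avg_restrict[of "{..<n}" H ?s] H(1) by simp
  have "(\<Sum>i\<in>J. (w i)\<^sup>2) / \<rho>\<^sup>2 \<le> \<eta>\<^sup>2" using V \<rho> by (simp add: J_def divide_le_eq)
  then have "?E \<le> 2 * (1 / 2 ^ card I) + 2 * \<eta>\<^sup>2" using b by (simp add: divide_inverse mult.commute mult.left_commute)
  then have "2 * ?E \<le> 4 * (1 / 2 ^ card I + \<eta>\<^sup>2)" by (simp add: algebra_simps)
  moreover have "\<bar>p - q\<bar> \<le> r" if "\<bar>p - s\<bar> \<le> e" "\<bar>q - s\<bar> \<le> e" "2 * e \<le> r" for p q r s e :: real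
    using that by linarith
  ultimately show ?thesis using 1 2 by blast
qed

section \<open>Greedy construction of the head\<close>

lemma tail_weight_insert:
  fixes w :: "nat \<Rightarrow> real"
  assumes "i < n" "i \<notin> H"
  shows "(\<Sum>j\<in>{..<n} - H. (w j)\<^sup>2) = (w i)\<^sup>2 + (\<Sum>j\<in>{..<n} - insert i H. (w j)\<^sup>2)"
proof -
  have "{..<n} - insert i H = ({..<n} - H) - {i}" by auto
  then show ?thesis using assms by (simp add: sum.remove[of _ i])
qed

lemma not_regular_square:
  fixes \<delta> u s :: real
  assumes "\<not> \<bar>u\<bar> \<le> \<delta> * sqrt s" "\<delta> > 0" "s \<ge> 0"
  shows "\<delta>\<^sup>2 * s \<le> u\<^sup>2"
proof -
  have "(\<delta> * sqrt s)\<^sup>2 \<le> \<bar>u\<bar>\<^sup>2" using assms by (intro power_mono) auto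
  then show ?thesis using assms(3) by (simp add: power_mult_distrib)
qed

text \<open>A weight violating regularity carries at least the fraction
  \<open>\<delta>\<^sup>2\<close> of the squared norm of the tail, which its move to the head
  removes. The start \<open>H0\<close> is arbitrary because the procedure is restarted after each
  new member of \<open>I\<close>.\<close>

lemma greedy_head:
  fixes w :: "nat \<Rightarrow> real"
  assumes \<delta>: "0 < \<delta>" "\<delta> \<le> 1" and H0: "H0 \<subseteq> {..<n}"
  shows "\<exists>H. H0 \<subseteq> H \<and> H \<subseteq> {..<n} \<and> card H \<le> card H0 + m \<and>
    ((\<forall>i\<in>{..<n} - H. \<bar>w i\<bar> \<le> \<delta> * sqrt (\<Sum>j\<in>{..<n} - H. (w j)\<^sup>2)) \<or>
     (\<Sum>j\<in>{..<n} - H. (w j)\<^sup>2) \<le> (1 - \<delta>\<^sup>2) ^ m * (\<Sum>j\<in>{..<n} - H0. (w j)\<^sup>2))"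
proof (induction m)
  case 0
  show ?case using H0 by (intro exI[of _ H0]) auto
next
  case (Suc m)
  let ?V = "\<lambda>H. \<Sum>j\<in>{..<n} - H. (w j)\<^sup>2"
  obtain H where H: "H0 \<subseteq> H" "H \<subseteq> {..<n}" "card H \<le> card H0 + m"
    and or: "(\<forall>i\<in>{..<n} - H. \<bar>w i\<bar> \<le> \<delta> * sqrt (?V H)) \<or> ?V H \<le> (1 - \<delta>\<^sup>2) ^ m * ?V H0"
    using Suc.IH by blast
  show ?case
  proof (cases "\<forall>i\<in>{..<n} - H. \<bar>w i\<bar> \<le> \<delta> * sqrt (?V H)")
    case True
    then show ?thesis using H by (intro exI[of _ H]) auto
  next
    case False
    then obtain i where i: "i < n" "i \<notin> H" "\<not> \<bar>w i\<bar> \<le> \<delta> * sqrt (?V H)" by auto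
    have V0: "?V H \<ge> 0" by (simp add: sum_nonneg)
    have "?V (insert i H) \<le> (1 - \<delta>\<^sup>2) * ?V H"
      using not_regular_square[OF i(3) \<delta>(1) V0] tail_weight_insert[OF i(1,2), of w] by (simp add: algebra_simps)
    also have "\<dots> \<le> (1 - \<delta>\<^sup>2) * ((1 - \<delta>\<^sup>2) ^ m * ?V H0)"
      using or False \<delta> by (intro mult_left_mono) (auto simp: power_le_one)
    finally have "?V (insert i H) \<le> (1 - \<delta>\<^sup>2) ^ Suc m * ?V H0" by (simp add: mult.assoc)
    moreover have "card (insert i H) \<le> card H0 + Suc m"
      using H i by (simp add: finite_subset)
    ultimately show ?thesis using H i by (intro exI[of _ "insert i H"]) auto
  qed
qed

text \<open>In each round one violating weight \<open>w i\<close> joins \<open>I\<close>, followed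
  by at most \<open>B\<close> greedy moves. These make the tail so small compared with
  \<open>w i\<close> that the invariant holds again with \<open>\<bar>w i\<bar> / 2\<close> as the
  new \<open>\<rho>\<close>.\<close>

lemma regular_or_separated_head:
  fixes w :: "nat \<Rightarrow> real"
  assumes \<delta>: "0 < \<delta>" "\<delta> \<le> 1" and \<eta>: "0 < \<eta>" "\<eta> \<le> 1 / 2" and B: "(1 - \<delta>\<^sup>2) ^ B \<le> (\<delta> * \<eta> / 2)\<^sup>2"
  shows "\<exists>H \<subseteq> {..<n}. card H \<le> r * (B + 1) \<and>
    ((\<forall>i\<in>{..<n} - H. \<bar>w i\<bar> \<le> \<delta> * sqrt (\<Sum>j\<in>{..<n} - H. (w j)\<^sup>2)) \<or>
     (\<exists>I \<rho>. I \<subseteq> H \<and> card I = r \<and> \<rho> > 0 \<and> separated w I \<rho> \<and> (\<Sum>j\<in>{..<n} - H. (w j)\<^sup>2) \<le> \<eta>\<^sup>2 * \<rho>\<^sup>2))"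
proof (induction r)
  case 0
  let ?s = "\<Sum>j<n. (w j)\<^sup>2"
  have s: "?s \<ge> 0" by (simp add: sum_nonneg)
  show ?case
  proof (cases "?s = 0")
    case True
    then have "\<forall>i<n. w i = 0" by (simp add: sum_nonneg_eq_0_iff)
    then show ?thesis by (intro exI[of _ "{}"]) auto
  next
    case False
    \<comment> \<open>The empty set is separated for any radius, so \<open>\<rho>\<close> can be
      chosen to give equality in the tail bound.\<close>
    have "separated w {} (sqrt ?s / \<eta>)" by (simp add: separated_def cube_on_empty)
    moreover have "?s = \<eta>\<^sup>2 * (sqrt ?s / \<eta>)\<^sup>2" using s \<eta> by (simp add: power_divide)
    ultimately show ?thesis using False s \<eta>
      by (intro exI[of _ "{}"]) (auto intro!: exI[of _ "sqrt ?s / \<eta>"])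
  qed
next
  case (Suc r)
  let ?V = "\<lambda>H. \<Sum>j\<in>{..<n} - H. (w j)\<^sup>2"
  let ?reg = "\<lambda>H. \<forall>i\<in>{..<n} - H. \<bar>w i\<bar> \<le> \<delta> * sqrt (?V H)"
  obtain H where H: "H \<subseteq> {..<n}" "card H \<le> r * (B + 1)"
    and or: "?reg H \<or> (\<exists>I \<rho>. I \<subseteq> H \<and> card I = r \<and> \<rho> > 0 \<and> separated w I \<rho> \<and> ?V H \<le> \<eta>\<^sup>2 * \<rho>\<^sup>2)"
    using Suc.IH by blast
  show ?case
  proof (cases "?reg H")
    case True
    then show ?thesis using H by (intro exI[of _ H]) auto
  next
    case False
    then obtain i where i: "i < n" "i \<notin> H" "\<not> \<bar>w i\<bar> \<le> \<delta> * sqrt (?V H)" by auto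
    from False or obtain I \<rho> where I: "I \<subseteq> H" "card I = r" "\<rho> > 0" "separated w I \<rho>" "?V H \<le> \<eta>\<^sup>2 * \<rho>\<^sup>2"
      by blast
    have fin: "finite H" "finite I"
      using finite_subset[OF H(1)] finite_subset[OF subset_trans[OF I(1) H(1)]] by auto
    have V0: "?V T \<ge> 0" for T by (simp add: sum_nonneg)
    have ins: "?V H = (w i)\<^sup>2 + ?V (insert i H)" by (rule tail_weight_insert[OF i(1,2)])
    have w: "w i \<noteq> 0" using i(3) \<delta> V0[of H] by auto
    obtain H' where H': "insert i H \<subseteq> H'" "H' \<subseteq> {..<n}" "card H' \<le> card (insert i H) + B"
      "?reg H' \<or> ?V H' \<le> (1 - \<delta>\<^sup>2) ^ B * ?V (insert i H)"
      using greedy_head[OF \<delta>, of "insert i H" n B w] H(1) i(1) by auto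
    have card: "card H' \<le> Suc r * (B + 1)" using H'(3) H(2) i(2) fin by simp
    show ?thesis
    proof (cases "?reg H'")
      case True
      then show ?thesis using H' card by (intro exI[of _ H']) auto
    next
      case False
      then have "?V H' \<le> (1 - \<delta>\<^sup>2) ^ B * ?V (insert i H)" using H'(4) by blast
      also have "\<dots> \<le> (\<delta> * \<eta> / 2)\<^sup>2 * ?V H"
        using B V0 ins by (intro mult_mono) auto
      also have "\<dots> = (\<eta> / 2)\<^sup>2 * (\<delta>\<^sup>2 * ?V H)" by (simp add: power_mult_distrib power_divide)
      also have "\<dots> \<le> (\<eta> / 2)\<^sup>2 * (w i)\<^sup>2"
        using not_regular_square[OF i(3) \<delta>(1) V0] by (intro mult_left_mono) auto
      also have "\<dots> = \<eta>\<^sup>2 * (\<bar>w i\<bar> / 2)\<^sup>2" by (simp add: power_divide)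
      finally have V: "?V H' \<le> \<eta>\<^sup>2 * (\<bar>w i\<bar> / 2)\<^sup>2" .
      \<comment> \<open>The old invariant bounds the new weight, since \<open>w i\<close> was part
        of the old tail. Thus \<open>\<bar>w i\<bar> \<le> \<rho> / 2\<close>, as separation
        requires.\<close>
      have "(w i)\<^sup>2 \<le> (\<eta> * \<rho>)\<^sup>2" using I(5) ins V0[of "insert i H"] by (simp add: power_mult_distrib)
      then have "\<bar>w i\<bar> \<le> \<eta> * \<rho>" using \<eta> I(3) by (simp add: abs_le_square_iff[symmetric] abs_mult)
      also have "\<dots> \<le> 1 / 2 * \<rho>" using \<eta> I(3) by (intro mult_right_mono) auto
      finally have "3 / 2 * \<bar>w i\<bar> \<le> \<rho>" using I(3) by linarith
      then have "separated w (insert i I) (\<bar>w i\<bar> / 2)"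
        using i(2) I(1,4) fin w by (intro separated_insert) auto
      moreover have "i \<notin> I" using I(1) i(2) by blast
      then have "card (insert i I) = Suc r" using fin I(2) by simp
      ultimately show ?thesis using H' card V w I(1)
        by (intro exI[of _ H']) (auto intro!: exI[of _ "insert i I"] exI[of _ "\<bar>w i\<bar> / 2"])
    qed
  qed
qed

section \<open>Choice of parameters\<close>

lemma nat_ceiling_bounds:
  fixes x :: real
  assumes "0 \<le> x"
  shows "x \<le> real (nat \<lceil>x\<rceil>)" "real (nat \<lceil>x\<rceil>) \<le> x + 1"
  using assms by linarith+

lemma fools_linear_threshold:
  assumes D: "distribution_on_cube n D" "k_wise_independent n k D" and \<epsilon>: "0 < \<epsilon>" "\<epsilon> \<le> 1 / 2"
    and k: "real k \<ge> (360 + 3 * (exp 13 + 2)) * 2400\<^sup>2 / \<epsilon>\<^sup>2 * (ln (1 / \<epsilon>))\<^sup>2"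
  shows "\<bar>(\<Sum>x\<in>cube n. pmf D x * sign_pm ((\<Sum>i<n. w i * x i) - \<theta>))
      - cube_avg {..<n} (\<lambda>x. sign_pm ((\<Sum>i<n. w i * x i) - \<theta>))\<bar> \<le> \<epsilon>"
proof -
  define L where "L = ln (1 / \<epsilon>)"
  have expL: "exp (- L) = \<epsilon>" using \<epsilon> by (simp add: L_def ln_div)
  have "ln 2 \<le> L" unfolding L_def using \<epsilon> by (intro ln_mono) (auto simp: field_simps)
  then have L: "2 / 3 \<le> L" using ln2_ge_two_thirds by linarith
  define \<delta> where "\<delta> = \<epsilon> / 2400"
  define \<eta> where "\<eta> = \<epsilon> / 4"
  have \<delta>: "0 < \<delta>" "\<delta> \<le> 1" and \<eta>: "0 < \<eta>" "\<eta> \<le> 1 / 2" using \<epsilon> by (auto simp: \<delta>_def \<eta>_def)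
  have d2: "0 < \<delta>\<^sup>2" "\<delta>\<^sup>2 \<le> 1" using \<delta> by (auto simp: power_le_one)
  have Ld: "L \<le> L / \<delta>\<^sup>2" using d2 L by (simp add: le_divide_eq mult_left_le)
  \<comment> \<open>\<open>r\<close> makes \<open>2 ^ r\<close> large against
    \<open>1 / \<epsilon>\<close>, \<open>B\<close> meets the shrinking condition of
    \<open>regular_or_separated_head\<close>, and the even number \<open>2 * m\<close> is the order
    of the moments for the regular case.\<close>
  define r where "r = nat \<lceil>8 * L\<rceil>"
  define B where "B = nat \<lceil>33 * L / \<delta>\<^sup>2\<rceil>"
  define m where "m = nat \<lceil>exp 13 / (8 * \<delta>\<^sup>2)\<rceil>"
  have r: "8 * L \<le> real r" "real r \<le> 8 * L + 1"
    unfolding r_def using L by (intro nat_ceiling_bounds; simp)+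
  have Bb: "33 * L / \<delta>\<^sup>2 \<le> real B" "real B \<le> 33 * L / \<delta>\<^sup>2 + 1"
    unfolding B_def using L by (intro nat_ceiling_bounds; simp)+
  have m: "exp 13 / (8 * \<delta>\<^sup>2) \<le> real m" "real m \<le> exp 13 / (8 * \<delta>\<^sup>2) + 1"
    unfolding m_def by (intro nat_ceiling_bounds; simp)+
  have "0 < exp 13 / (8 * \<delta>\<^sup>2)" using d2 by simp
  with m(1) have m0: "m > 0" by linarith
  have B: "(1 - \<delta>\<^sup>2) ^ B \<le> (\<delta> * \<eta> / 2)\<^sup>2"
  proof -
    have "1 - \<delta>\<^sup>2 \<le> exp (- \<delta>\<^sup>2)" using exp_ge_add_one_self[of "- \<delta>\<^sup>2"] by simp
    then have "(1 - \<delta>\<^sup>2) ^ B \<le> exp (- \<delta>\<^sup>2) ^ B" using d2 by (intro power_mono) auto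
    also have "\<dots> = exp (- (real B * \<delta>\<^sup>2))" by (simp add: exp_of_nat_mult[symmetric])
    also have "\<dots> \<le> exp (real 33 * (- L))" using Bb(1) d2 by (simp add: field_simps)
    also have "\<dots> = \<epsilon> ^ 4 * \<epsilon> ^ 29" unfolding exp_of_nat_mult expL by (simp flip: power_add)
    also have "\<dots> \<le> \<epsilon> ^ 4 * (1 / 2) ^ 29" using \<epsilon> by (intro mult_left_mono power_mono) auto
    \<comment> \<open>19200 is 2400 * 4 * 2, from \<delta>, \<eta> and the halving, and its square
      is below \<open>2 ^ 29\<close>; this is why 33 = 4 + 29 is used in \<open>B\<close>.\<close>
    also have "\<dots> \<le> \<epsilon> ^ 4 * (1 / 19200)\<^sup>2" using \<epsilon> by (intro mult_left_mono) (auto simp: power_divide)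
    also have "\<dots> = (\<delta> * \<eta> / 2)\<^sup>2" by (simp add: \<delta>_def \<eta>_def power_divide power_mult_distrib flip: power_mult)
    finally show ?thesis .
  qed
  obtain H where H: "H \<subseteq> {..<n}" "card H \<le> r * (B + 1)"
    and or: "(\<forall>i\<in>{..<n} - H. \<bar>w i\<bar> \<le> \<delta> * sqrt (\<Sum>j\<in>{..<n} - H. (w j)\<^sup>2)) \<or>
     (\<exists>I \<rho>. I \<subseteq> H \<and> card I = r \<and> \<rho> > 0 \<and> separated w I \<rho> \<and> (\<Sum>j\<in>{..<n} - H. (w j)\<^sup>2) \<le> \<eta>\<^sup>2 * \<rho>\<^sup>2)"
    using regular_or_separated_head[OF \<delta> \<eta> B, of n r w] by blast
  have cH: "real (card H) \<le> 360 * L\<^sup>2 / \<delta>\<^sup>2"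
  proof -
    have "real (card H) \<le> real r * (real B + 1)" using H(2) by (metis of_nat_1 of_nat_add of_nat_le_iff of_nat_mult)
    \<comment> \<open>The rounding terms are absorbed using \<open>L \<ge> 2 / 3\<close> and
      \<open>L \<le> L / \<delta>\<^sup>2\<close>.\<close>
    also have "\<dots> \<le> (10 * L) * (36 * (L / \<delta>\<^sup>2))"
      using r Bb L Ld by (intro mult_mono) auto
    also have "\<dots> = 360 * L\<^sup>2 / \<delta>\<^sup>2" by (simp add: power2_eq_square)
    finally show ?thesis .
  qed
  have cm: "real (2 * m) \<le> 3 * (exp 13 + 2) * L\<^sup>2 / \<delta>\<^sup>2"
  proof -
    have "real (2 * m) \<le> exp 13 / (4 * \<delta>\<^sup>2) + 2" using m(2) by simp
    also have "\<dots> \<le> exp 13 / \<delta>\<^sup>2 + 2 / \<delta>\<^sup>2"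
      using d2 by (intro add_mono) (auto simp: field_simps)
    also have "\<dots> = (exp 13 + 2) * (1 / \<delta>\<^sup>2)" by (simp add: add_divide_distrib)
    also have "\<dots> \<le> (exp 13 + 2) * (3 * L\<^sup>2 / \<delta>\<^sup>2)"
    proof (intro mult_left_mono divide_right_mono)
      have "(2 / 3)\<^sup>2 \<le> L\<^sup>2" using L by (intro power_mono) auto
      then show "1 \<le> 3 * L\<^sup>2" by (simp add: power_divide)
    qed (use d2 in \<open>auto intro: add_nonneg_nonneg\<close>)
    finally show ?thesis by (simp add: algebra_simps)
  qed
  have "real (card H + 2 * m) \<le> (360 + 3 * (exp 13 + 2)) * L\<^sup>2 / \<delta>\<^sup>2"
    using cH cm by (simp add: distrib_right add_divide_distrib)
  also have "\<dots> = (360 + 3 * (exp 13 + 2)) * 2400\<^sup>2 / \<epsilon>\<^sup>2 * L\<^sup>2"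
    by (simp add: \<delta>_def power_divide)
  also have "\<dots> \<le> real k" using k by (simp add: L_def)
  finally have budget: "card H + 2 * m \<le> k" by linarith
  from or show ?thesis
  proof
    assume reg: "\<forall>i\<in>{..<n} - H. \<bar>w i\<bar> \<le> \<delta> * sqrt (\<Sum>j\<in>{..<n} - H. (w j)\<^sup>2)"
    have "real (2 * m) \<ge> exp 13 / (4 * \<delta>\<^sup>2)" using m(1) by simp
    then have "\<bar>(\<Sum>x\<in>cube n. pmf D x * sign_pm ((\<Sum>i<n. w i * x i) - \<theta>))
      - cube_avg {..<n} (\<lambda>x. sign_pm ((\<Sum>i<n. w i * x i) - \<theta>))\<bar> \<le> 2400 * \<delta>"
      using reg m0 budget by (intro fools_regular_tail[OF D H(1) \<delta>(1), where ?k0.0 = "2 * m"]) auto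
    then show ?thesis by (simp add: \<delta>_def)
  next
    assume "\<exists>I \<rho>. I \<subseteq> H \<and> card I = r \<and> \<rho> > 0 \<and> separated w I \<rho> \<and> (\<Sum>j\<in>{..<n} - H. (w j)\<^sup>2) \<le> \<eta>\<^sup>2 * \<rho>\<^sup>2"
    then obtain I \<rho> where I: "I \<subseteq> H" "card I = r" "\<rho> > 0" "separated w I \<rho>" "(\<Sum>j\<in>{..<n} - H. (w j)\<^sup>2) \<le> \<eta>\<^sup>2 * \<rho>\<^sup>2"
      by blast
    have "\<bar>(\<Sum>x\<in>cube n. pmf D x * sign_pm ((\<Sum>i<n. w i * x i) - \<theta>))
      - cube_avg {..<n} (\<lambda>x. sign_pm ((\<Sum>i<n. w i * x i) - \<theta>))\<bar> \<le> 4 * (1 / 2 ^ r + \<eta>\<^sup>2)"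
      using fools_separated_head[OF D H(1) _ _ I(1,4,3,5)] budget m0 unfolding I(2) by simp
    also have "\<dots> \<le> 4 * (\<epsilon> / 8 + \<epsilon> / 8)"
    proof (intro mult_left_mono add_mono)
      have "1 / 2 ^ r = exp (- ln (2::real)) ^ r" by (simp add: exp_minus power_one_over inverse_eq_divide)
      also have "\<dots> = exp (- (real r * ln 2))" by (simp add: exp_of_nat_mult[symmetric])
      also have "\<dots> \<le> exp (real 4 * (- L))"
      proof -
        have "(8 * L) * (1 / 2) \<le> real r * ln 2"
          using r(1) L ln2_ge_two_thirds by (intro mult_mono) auto
        then show ?thesis by simp
      qed
      also have "\<dots> = \<epsilon> * \<epsilon> ^ 3" unfolding exp_of_nat_mult expL by (simp add: eval_nat_numeral)
      also have "\<dots> \<le> \<epsilon> * (1 / 2) ^ 3" using \<epsilon> by (intro mult_left_mono power_mono) auto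
      finally show "1 / 2 ^ r \<le> \<epsilon> / 8" by (simp add: power_divide)
      have "\<epsilon> * \<epsilon> \<le> \<epsilon> * (1 / 2)" using \<epsilon> by (intro mult_left_mono) auto
      then show "\<eta>\<^sup>2 \<le> \<epsilon> / 8" using \<epsilon> by (simp add: \<eta>_def power2_eq_square)
    qed simp
    also have "\<dots> = \<epsilon>" by simp
    finally show ?thesis .
  qed
qed

theorem theorem1p2:
  "\<exists>C::real. C > 0 \<and>
     (\<forall>(n::nat) (\<epsilon>::real) (k::nat) (D :: (nat \<Rightarrow> real) pmf) (h :: (nat \<Rightarrow> real) \<Rightarrow> real).
        n \<ge> 1 \<longrightarrow> 0 < \<epsilon> \<longrightarrow> \<epsilon> \<le> 1 / 2 \<longrightarrow>
        real k \<ge> C / \<epsilon>\<^sup>2 * (ln (1 / \<epsilon>))\<^sup>2 \<longrightarrow>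
        distribution_on_cube n D \<longrightarrow> k_wise_independent n k D \<longrightarrow>
        halfspace n h \<longrightarrow>
        fools n D h \<epsilon>)"
proof (intro exI conjI allI impI)
  show "(360 + 3 * (exp 13 + 2)) * 2400\<^sup>2 > (0::real)"
    by (intro mult_pos_pos add_pos_pos) auto
  fix n k :: nat and \<epsilon> :: real and D :: "(nat \<Rightarrow> real) pmf" and h :: "(nat \<Rightarrow> real) \<Rightarrow> real"
  assume \<epsilon>: "0 < \<epsilon>" "\<epsilon> \<le> 1 / 2"
    and k: "real k \<ge> (360 + 3 * (exp 13 + 2)) * 2400\<^sup>2 / \<epsilon>\<^sup>2 * (ln (1 / \<epsilon>))\<^sup>2"
    and D: "distribution_on_cube n D" "k_wise_independent n k D" and "halfspace n h"
  then obtain w \<theta> where h: "\<And>x. x \<in> cube n \<Longrightarrow> h x = sign_pm ((\<Sum>i<n. w i * x i) - \<theta>)"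
    by (auto simp: halfspace_def)
  \<comment> \<open>Both expectations are finite sums over the cube, so the values of
    \<open>h\<close> elsewhere do not enter.\<close>
  have "(\<Sum>x\<in>cube n. pmf D x * h x) = (\<Sum>x\<in>cube n. pmf D x * sign_pm ((\<Sum>i<n. w i * x i) - \<theta>))"
    by (intro sum.cong) (auto simp: h)
  moreover have "cube_avg {..<n} h = cube_avg {..<n} (\<lambda>x. sign_pm ((\<Sum>i<n. w i * x i) - \<theta>))"
    by (intro cube_avg_cong h)
  ultimately show "fools n D h \<epsilon>"
    unfolding fools_def expectation_on_cube[OF D(1)] expectation_uniform[OF finite_lessThan]
    using fools_linear_threshold[OF D \<epsilon> k, of w \<theta>] by (simp only:)
qed

end
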